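(* Let $n\ge 3$. (i) The number of projective equivalence classes of non-decomposable full-dimensional pointed polyhedral cones in $\mathbb{R}^n$ with exactly $n+1$ extreme rays is $\lfloor (n-1)/2\rfloor$. (ii) The number of projective equivalence classes of full-dimensional pointed polyhedral cones in $\mathbb{R}^n$ with exactly $n+1$ extreme rays is $p(p-1)$ if $n=2p$, and $p^2$ if $n=2p+1$.
   Context: A polyhedral cone in $\mathbb{R}^n$ is the set of vectors satisfying finitely many homogeneous linear inequalities; it is assumed full-dimensional and containing no nontrivial linear subspace, so it is generated (by nonnegative combinations) by its finitely many extreme rays. Two such cones $\mathcal{C},\mathcal{C}'\subseteq\mathbb{R}^n$ are projectively equivalent if there is $A\in\mathrm{GL}_n(\mathbb{R})$ with $A\mathcal{C}=\mathcal{C}'$ (so $A$ maps the extreme rays of $\mathcal{C}$ bijectively onto those of $\mathcal{C}'$). A cone in a vector space $V$ with set of extreme rays $E$ is decomposable if there are nonzero subspaces $V_1,V_2$ with $V=V_1\oplus V_2$ and every ray of $E$ contained in $V_1$ or in $V_2$; otherwise it is non-decomposable. *)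

theory Defs
  imports "HOL-Analysis.Analysis"
begin

definition polyhedral_cone :: "'a::euclidean_space set \<Rightarrow> bool" where
  "polyhedral_cone C \<longleftrightarrow> (\<exists>H. finite H \<and> C = {x. \<forall>a\<in>H. a \<bullet> x \<ge> 0})"

definition pointed_cone :: "'a::euclidean_space set \<Rightarrow> bool" where
  "pointed_cone C \<longleftrightarrow> (\<forall>S. subspace S \<and> S \<subseteq> C \<longrightarrow> S = {0})"

definition full_dimensional :: "'a::euclidean_space set \<Rightarrow> bool" where
  "full_dimensional C \<longleftrightarrow> aff_dim C = int DIM('a)"

text \<open>For a pointed polyhedral cone, a face of dimension one is a ray issuing from the origin
  (with the origin included).\<close>

definition extreme_rays :: "'a::euclidean_space set \<Rightarrow> 'a set set" where
  "extreme_rays C = {F. F face_of C \<and> aff_dim F = 1}"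

definition decomposable :: "'a::euclidean_space set \<Rightarrow> bool" where
  "decomposable C \<longleftrightarrow>
    (\<exists>V\<^sub>1 V\<^sub>2. subspace V\<^sub>1 \<and> subspace V\<^sub>2 \<and> V\<^sub>1 \<noteq> {0} \<and> V\<^sub>2 \<noteq> {0} \<and>
      V\<^sub>1 \<inter> V\<^sub>2 = {0} \<and> {x + y | x y. x \<in> V\<^sub>1 \<and> y \<in> V\<^sub>2} = UNIV \<and>
      (\<forall>R\<in>extreme_rays C. R \<subseteq> V\<^sub>1 \<or> R \<subseteq> V\<^sub>2))"

definition projectively_equivalent :: "(real ^ 'n) set \<Rightarrow> (real ^ 'n) set \<Rightarrow> bool" where
  "projectively_equivalent C D \<longleftrightarrow>
    (\<exists>A :: real ^ 'n ^ 'n. invertible A \<and> (\<lambda>x. A *v x) ` C = D)"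

definition projective_equivalence_on :: "(real ^ 'n) set set \<Rightarrow> ((real ^ 'n) set) rel" where
  "projective_equivalence_on \<C> = {(C, D). C \<in> \<C> \<and> D \<in> \<C> \<and> projectively_equivalent C D}"

definition projective_classes :: "(real ^ 'n) set set \<Rightarrow> (real ^ 'n) set set set" where
  "projective_classes \<C> = \<C> // projective_equivalence_on \<C>"

definition cones_with_rays :: "nat \<Rightarrow> 'a::euclidean_space set set" where
  "cones_with_rays k =
    {C. polyhedral_cone C \<and> full_dimensional C \<and> pointed_cone C \<and> card (extreme_rays C) = k}"

lemma equiv_projective_equivalence_on: "equiv \<C> (projective_equivalence_on \<C>)"
proof (rule equivI)
  show "projective_equivalence_on \<C> \<subseteq> \<C> \<times> \<C>"
    by (auto simp: projective_equivalence_on_def)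
  have "projectively_equivalent C C" for C :: "(real ^ 'n) set"
    unfolding projectively_equivalent_def
    by (rule exI[of _ "mat 1"]) (auto simp: invertible_def)
  then show "refl_on \<C> (projective_equivalence_on \<C>)"
    by (auto simp: projective_equivalence_on_def refl_on_def)
  have "projectively_equivalent D C" if "projectively_equivalent C D" for C D :: "(real ^ 'n) set"
  proof -
    from that obtain A B :: "real ^ 'n ^ 'n" where
      AB: "A ** B = mat 1" "B ** A = mat 1" and D: "D = (\<lambda>x. A *v x) ` C"
      unfolding projectively_equivalent_def invertible_def by blast
    have "(\<lambda>x. B *v x) ` D = C"
      by (simp add: D image_image matrix_vector_mul_assoc AB)
    moreover have "invertible B"
      using AB unfolding invertible_def by blast
    ultimately show ?thesis
      unfolding projectively_equivalent_def by blast
  qed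
  then show "sym (projective_equivalence_on \<C>)"
    by (auto simp: projective_equivalence_on_def sym_def)
  have "projectively_equivalent C E"
    if "projectively_equivalent C D" "projectively_equivalent D E" for C D E :: "(real ^ 'n) set"
  proof -
    from that obtain A B :: "real ^ 'n ^ 'n" where
      AB: "invertible A" "invertible B" and "D = (\<lambda>x. A *v x) ` C" "E = (\<lambda>x. B *v x) ` D"
      unfolding projectively_equivalent_def by blast
    then have "(\<lambda>x. (B ** A) *v x) ` C = E"
      by (simp add: image_image matrix_vector_mul_assoc)
    moreover have "invertible (B ** A)"
      using AB by (simp add: invertible_mult)
    ultimately show ?thesis
      unfolding projectively_equivalent_def by blast
  qed
  then show "trans (projective_equivalence_on \<C>)"
    unfolding projective_equivalence_on_def trans_def by blast
qed

end

theory Submission imports Defs begin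

text \<open>The \<open>n + 1\<close> extreme rays of such a cone span \<open>\<real>\<^sup>n\<close>, so generators of them satisfy
  exactly one linear relation up to a scalar. Rescaling the generators makes all its coefficients
  \<open>1\<close>, \<open>-1\<close> or \<open>0\<close>. The cone is pointed and all generators are extreme precisely if at least two
  coefficients are \<open>1\<close> and at least two are \<open>-1\<close>, and the unordered pair of these two numbers is a
  complete projective invariant. A vanishing coefficient splits off the corresponding ray, so the
  cone is non-decomposable precisely if no coefficient vanishes. It remains to count pairs
  \<open>2 \<le> a \<le> b\<close> with \<open>a + b = n + 1\<close>, respectively \<open>a + b \<le> n + 1\<close>.\<close>

subsection \<open>Finitely generated cones and their extreme rays\<close>

text \<open>Cones are given by inequalities and extreme rays by faces, while the invariant lives on
  generators. Both translations are needed: Minkowski's theorem recovers a pointed cone from its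
  extreme rays, Weyl's theorem makes a generated cone polyhedral. The threshold two has a reason in
  each direction. A nontrivial relation without positive coefficients puts a line into the cone; one
  with a single positive coefficient writes a multiple of that generator as a nonnegative
  combination of the others, against extremality. Conversely, with two coefficients of each sign,
  deleting any one index leaves both signs present, so a relation that is nonnegative outside one
  index must be trivial. Pointedness, nonzero generators, distinct rays and extremality are all
  instances of this one fact. Negating the relation swaps the two numbers, so frames carry no order
  between \<open>a\<close> and \<open>b\<close>; \<open>a \<le> b\<close> is imposed only to choose
  one representative per unordered pair.\<close>

definition ray :: "'a::real_vector \<Rightarrow> 'a set" where
  "ray v = {t *\<^sub>R v | t. 0 \<le> t}"

text \<open>An indexed family instead of a set of generators: coefficients belong to indices, so the
  family can be permuted and rescaled, and distinctness of the vectors can be proved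
  afterwards.\<close>

definition cone_generated_by :: "'i set \<Rightarrow> ('i \<Rightarrow> 'a::real_vector) \<Rightarrow> 'a set" where
  "cone_generated_by I f = {(\<Sum>i\<in>I. u i *\<^sub>R f i) | u. \<forall>i\<in>I. 0 \<le> u i}"

lemma ray_scaleR: "0 < t \<Longrightarrow> ray (t *\<^sub>R v) = ray v"
proof -
  assume t: "0 < t"
  have "s *\<^sub>R v = (s / t) *\<^sub>R t *\<^sub>R v" for s
    using t by simp
  moreover have "0 \<le> s / t" if "0 \<le> s" for s
    using t that by simp
  ultimately show ?thesis
    using t unfolding ray_def by fastforce
qed

lemma self_in_ray: "v \<in> ray v"
  unfolding ray_def by (auto intro: exI[of _ 1])

lemma zero_in_ray: "0 \<in> ray v"
  unfolding ray_def by (auto intro: exI[of _ 0])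

lemma ray_eqD:
  assumes "ray v = ray w" "v \<noteq> 0"
  obtains t where "0 < t" "v = t *\<^sub>R w"
proof -
  have "v \<in> ray w"
    using assms self_in_ray by metis
  then obtain t where "0 \<le> t" "v = t *\<^sub>R w"
    unfolding ray_def by blast
  with \<open>v \<noteq> 0\<close> that show ?thesis
    by (cases "t = 0") auto
qed

lemma ray_subset_span: "v \<in> S \<Longrightarrow> ray v \<subseteq> span S"
  unfolding ray_def by (auto intro: span_mul span_base)

lemma convex_ray: "convex (ray v)"
proof (rule convexI)
  fix x y and u w :: real
  assume "x \<in> ray v" "y \<in> ray v" "0 \<le> u" "0 \<le> w" "u + w = 1"
  then obtain s t where "0 \<le> s" "0 \<le> t" "x = s *\<^sub>R v" "y = t *\<^sub>R v"
    unfolding ray_def by blast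
  then have "u *\<^sub>R x + w *\<^sub>R y = (u * s + w * t) *\<^sub>R v" "0 \<le> u * s + w * t"
    using \<open>0 \<le> u\<close> \<open>0 \<le> w\<close> by (auto simp: algebra_simps)
  then show "u *\<^sub>R x + w *\<^sub>R y \<in> ray v"
    unfolding ray_def by blast
qed

lemma aff_dim_ray:
  fixes v :: "'a::euclidean_space"
  assumes "v \<noteq> 0"
  shows "aff_dim (ray v) = 1"
proof -
  have "span (ray v) = span {v}"
    unfolding span_eq
  proof
    show "ray v \<subseteq> span {v}"
      by (simp add: ray_subset_span)
    show "{v} \<subseteq> span (ray v)"
      using self_in_ray by (auto intro: span_base)
  qed
  then have "dim (ray v) = 1"
    using assms by (metis dim_span dim_singleton)
  moreover have "0 \<in> affine hull ray v"
    using zero_in_ray hull_inc by metis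
  ultimately show ?thesis
    by (simp add: aff_dim_zero)
qed

lemma convex_cone_generated:
  assumes "finite I"
  shows "convex_cone (cone_generated_by I f)"
  unfolding convex_cone_iff
proof (intro conjI ballI allI impI)
  show "0 \<in> cone_generated_by I f"
    unfolding cone_generated_by_def by (auto intro!: exI[of _ "\<lambda>_. 0"])
next
  fix x y
  assume "x \<in> cone_generated_by I f" "y \<in> cone_generated_by I f"
  then obtain u v where "\<forall>i\<in>I. 0 \<le> u i" "x = (\<Sum>i\<in>I. u i *\<^sub>R f i)"
    "\<forall>i\<in>I. 0 \<le> v i" "y = (\<Sum>i\<in>I. v i *\<^sub>R f i)"
    unfolding cone_generated_by_def by blast
  then show "x + y \<in> cone_generated_by I f"
    unfolding cone_generated_by_def
    by (auto intro!: exI[of _ "\<lambda>i. u i + v i"] simp: scaleR_left_distrib sum.distrib)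
next
  fix x and c :: real
  assume "x \<in> cone_generated_by I f" "0 \<le> c"
  then obtain u where "\<forall>i\<in>I. 0 \<le> u i" "x = (\<Sum>i\<in>I. u i *\<^sub>R f i)"
    unfolding cone_generated_by_def by blast
  with \<open>0 \<le> c\<close> show "c *\<^sub>R x \<in> cone_generated_by I f"
    unfolding cone_generated_by_def
    by (auto intro!: exI[of _ "\<lambda>i. c * u i"] simp: scaleR_sum_right)
qed

lemma generator_in_cone:
  assumes "finite I" "i \<in> I"
  shows "f i \<in> cone_generated_by I f"
  unfolding cone_generated_by_def
  using assms by (auto intro!: exI[of _ "\<lambda>j. if j = i then 1 else 0"] simp: if_distrib[of "\<lambda>c. c *\<^sub>R _"] cong: if_cong)

lemma generators_subset_cone:
  assumes "finite I"
  shows "f ` I \<subseteq> cone_generated_by I f"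
proof (rule image_subsetI)
  show "f i \<in> cone_generated_by I f" if "i \<in> I" for i
    by (rule generator_in_cone[OF assms that])
qed

lemma convex_cone_sum:
  assumes "convex_cone S" "\<And>i. i \<in> I \<Longrightarrow> x i \<in> S"
  shows "sum x I \<in> S"
  using assms(2)
  by (induction I rule: infinite_finite_induct)
     (auto intro: convex_cone_contains_0[OF assms(1)] convex_cone_add[OF assms(1)])

lemma cone_generated_subset:
  assumes "convex_cone S" "f ` I \<subseteq> S"
  shows "cone_generated_by I f \<subseteq> S"
proof
  fix x
  assume "x \<in> cone_generated_by I f"
  then obtain u where u: "\<forall>i\<in>I. 0 \<le> u i" "x = (\<Sum>i\<in>I. u i *\<^sub>R f i)"
    unfolding cone_generated_by_def by blast
  have "(\<Sum>i\<in>I. u i *\<^sub>R f i) \<in> S"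
    by (rule convex_cone_sum[OF assms(1)]) (use assms u convex_cone_scaleR in blast)
  then show "x \<in> S"
    using u by simp
qed

lemma cone_generated_eq_hull:
  assumes "finite I"
  shows "cone_generated_by I f = convex_cone hull (f ` I)"
proof
  show "cone_generated_by I f \<subseteq> convex_cone hull (f ` I)"
    by (rule cone_generated_subset[OF convex_cone_convex_cone_hull hull_subset])
  show "convex_cone hull (f ` I) \<subseteq> cone_generated_by I f"
    by (rule hull_minimal) (auto simp: convex_cone_generated assms generator_in_cone)
qed

text \<open>The library notion allows affine inequalities. For a cone, the origin forces nonnegative
  right-hand sides, and scaling shows that each inequality already holds with right-hand side
  zero.\<close>

lemma polyhedral_cone_if_polyhedron:
  assumes "polyhedron C" "convex_cone C"
  shows "polyhedral_cone C"
proof -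
  obtain F where F: "finite F" "C = \<Inter>F" "\<forall>h\<in>F. \<exists>a b. a \<noteq> 0 \<and> h = {x. a \<bullet> x \<le> b}"
    using assms(1) unfolding polyhedron_def by blast
  then obtain a b where "\<And>h. h \<in> F \<Longrightarrow> h = {x. a h \<bullet> x \<le> b h}"
    by metis
  then have ab: "x \<in> h \<longleftrightarrow> a h \<bullet> x \<le> b h" if "h \<in> F" for x h
    using that by blast
  have "0 \<in> C"
    by (rule convex_cone_contains_0[OF assms(2)])
  then have b: "0 \<le> b h" if "h \<in> F" for h
    using F(2) ab[OF that, of 0] that by simp
  have neg: "a h \<bullet> x \<le> 0" if "x \<in> C" "h \<in> F" for x h
  proof (rule ccontr)
    assume *: "\<not> a h \<bullet> x \<le> 0"
    \<comment> \<open>Chosen so that \<open>a h\<close> takes the value \<open>b h + 1\<close> at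
      \<open>t *\<^sub>R x\<close>, just beyond the bound.\<close>
    define t where "t = (b h + 1) / (a h \<bullet> x)"
    have "0 \<le> t"
      using * b[OF that(2)] unfolding t_def by simp
    then have "t *\<^sub>R x \<in> C"
      by (rule convex_cone_scaleR[OF assms(2) _ that(1)])
    then have "a h \<bullet> (t *\<^sub>R x) \<le> b h"
      using F(2) ab[OF that(2)] that(2) by blast
    then show False
      using * unfolding t_def by simp
  qed
  have "C = {x. \<forall>c\<in>(\<lambda>h. - a h) ` F. c \<bullet> x \<ge> 0}"
  proof
    show "C \<subseteq> {x. \<forall>c\<in>(\<lambda>h. - a h) ` F. c \<bullet> x \<ge> 0}"
      using neg by auto
    show "{x. \<forall>c\<in>(\<lambda>h. - a h) ` F. c \<bullet> x \<ge> 0} \<subseteq> C"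
      using F(2) ab b by (fastforce intro: order_trans)
  qed
  then show ?thesis
    unfolding polyhedral_cone_def using F(1) by blast
qed

text \<open>Weyl's theorem, the direction by which a frame yields an admissible cone.\<close>

lemma polyhedral_cone_generated:
  fixes f :: "'i \<Rightarrow> 'a::euclidean_space"
  assumes "finite I"
  shows "polyhedral_cone (cone_generated_by I f)"
  by (rule polyhedral_cone_if_polyhedron)
     (simp_all add: assms cone_generated_eq_hull polyhedron_convex_cone_hull convex_cone_convex_cone_hull)

section \<open>Pointedness and faces of convex cones\<close>

lemma convex_cone_polyhedral_cone:
  assumes "polyhedral_cone C"
  shows "convex_cone C"
  using assms unfolding polyhedral_cone_def convex_cone_iff
  by (auto simp: inner_right_distrib)

lemma pointed_cone_iff:
  assumes "convex_cone C"
  shows "pointed_cone C \<longleftrightarrow> (\<forall>x. x \<in> C \<and> - x \<in> C \<longrightarrow> x = 0)"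
proof
  assume p: "pointed_cone C"
  show "\<forall>x. x \<in> C \<and> - x \<in> C \<longrightarrow> x = 0"
  proof (intro allI impI)
    fix x
    assume x: "x \<in> C \<and> - x \<in> C"
    have "k *\<^sub>R x \<in> C" for k
    proof (cases "0 \<le> k")
      case True
      then show ?thesis
        using x convex_cone_scaleR[OF assms] by blast
    next
      case False
      then have "(- k) *\<^sub>R (- x) \<in> C"
        by (intro convex_cone_scaleR[OF assms]) (use x in auto)
      then show ?thesis
        by simp
    qed
    then have "span {x} \<subseteq> C"
      by (auto simp: span_singleton)
    then have "span {x} = {0}"
      using p unfolding pointed_cone_def by (meson subspace_span)
    then show "x = 0"
      using span_base[of x "{x}"] by simp
  qed
next
  assume "\<forall>x. x \<in> C \<and> - x \<in> C \<longrightarrow> x = 0"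
  then show "pointed_cone C"
    unfolding pointed_cone_def using subspace_neg subspace_0 by blast
qed

text \<open>The midpoint of \<open>x\<close> and \<open>y\<close> is a multiple of
  \<open>x + y\<close>, hence lies in the conic set \<open>F\<close>. This additive form of the face
  property suits sums of generators.\<close>

lemma face_of_convex_cone_addD:
  assumes C: "convex_cone C" and F: "F face_of C" and "x \<in> C" "y \<in> C" "x + y \<in> F"
  shows "x \<in> F \<and> y \<in> F"
proof -
  have con: "conic F"
    using C F face_of_conic unfolding convex_cone_def by blast
  have half: "(1/2) *\<^sub>R (x + y) \<in> F"
    by (rule conicD[OF con]) (use assms in auto)
  show ?thesis
  \<comment> \<open>The open segment is empty when its endpoints coincide, so this case is
    separate.\<close>
  proof (cases "x = y")
    case True
    then have "(1/2) *\<^sub>R (x + y) = x"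
      by (simp flip: scaleR_2)
    with half True show ?thesis
      by simp
  next
    case False
    have "(1/2) *\<^sub>R (x + y) \<in> open_segment x y"
      unfolding in_segment using False
      by (auto intro!: exI[of _ "1/2"] simp: scaleR_right_distrib)
    then show ?thesis
      using face_ofD[OF F _ \<open>x \<in> C\<close> \<open>y \<in> C\<close> half] by blast
  qed
qed

text \<open>The weights of a convex combination can be absorbed into its endpoints and divided out
  again, so testing sums is enough.\<close>

lemma face_of_convex_coneI:
  assumes C: "convex_cone C" and "convex_cone F" "F \<subseteq> C"
    and add: "\<And>x y. x \<in> C \<Longrightarrow> y \<in> C \<Longrightarrow> x + y \<in> F \<Longrightarrow> x \<in> F \<and> y \<in> F"
  shows "F face_of C"
  unfolding face_of_def
proof (intro conjI ballI impI)
  show "convex F"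
    using assms unfolding convex_cone_def by blast
  fix a b x
  assume "a \<in> C" "b \<in> C" "x \<in> F" "x \<in> open_segment a b"
  then obtain u where u: "0 < u" "u < 1" "x = (1 - u) *\<^sub>R a + u *\<^sub>R b"
    unfolding in_segment by blast
  have "(1 - u) *\<^sub>R a \<in> F \<and> u *\<^sub>R b \<in> F"
    by (rule add) (use u \<open>a \<in> C\<close> \<open>b \<in> C\<close> \<open>x \<in> F\<close> convex_cone_scaleR[OF C] in auto)
  then have "(1 / (1 - u)) *\<^sub>R (1 - u) *\<^sub>R a \<in> F" "(1 / u) *\<^sub>R u *\<^sub>R b \<in> F"
    using u by (auto simp del: scaleR_scaleR intro!: convex_cone_scaleR[OF assms(2)])
  then show "a \<in> F" "b \<in> F"
    using u by simp_all
qed (use assms in auto)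

lemma convex_cone_ray: "convex_cone (ray v)"
  unfolding convex_cone_def conic_def
  using convex_ray zero_in_ray by (fastforce simp: ray_def)

text \<open>Such a face lies on one line through the origin; being conic it contains the half-line
  of \<open>v\<close>, and pointedness excludes the opposite half.\<close>

lemma aff_dim_1_conic_face_eq_ray:
  fixes C :: "'a::euclidean_space set"
  assumes C: "convex_cone C" "pointed_cone C" and F: "F \<in> extreme_rays C" and v: "v \<in> F" "v \<noteq> 0"
  shows "F = ray v"
proof
  have face: "F face_of C" "aff_dim F = 1"
    using F unfolding extreme_rays_def by auto
  have con: "conic F"
    using C face face_of_conic unfolding convex_cone_def by blast
  have "0 \<in> F"
    using con v conic_contains_0 by auto
  show "ray v \<subseteq> F"
    using conicD[OF con v(1)] unfolding ray_def by blast
  have "dim F = 1"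
    using face(2) aff_dim_zero[of F] \<open>0 \<in> F\<close> by (simp add: hull_inc)
  have "span {v} = span F"
  proof (rule dim_eq_span)
    show "{v} \<subseteq> F"
      using v by simp
    show "dim F \<le> dim {v}"
      using \<open>dim F = 1\<close> v by simp
  qed
  show "F \<subseteq> ray v"
  proof
    fix x
    assume x: "x \<in> F"
    then have "x \<in> span {v}"
      using \<open>span {v} = span F\<close> span_base by blast
    then obtain k where k: "x = k *\<^sub>R v"
      by (auto simp: span_singleton)
    show "x \<in> ray v"
    proof (cases "0 \<le> k")
      case True
      then show ?thesis
        using k unfolding ray_def by blast
    next
      case False
      have "(- k) *\<^sub>R v \<in> F"
        by (rule conicD[OF con v(1)]) (use False in simp)
      then have "x \<in> C \<and> - x \<in> C"
        using k x face_of_imp_subset[OF face(1)] by auto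
      then have "x = 0"
        using C pointed_cone_iff by blast
      then show ?thesis
        using zero_in_ray by simp
    qed
  qed
qed

lemma extreme_ray_obtains_generator:
  fixes C :: "'a::euclidean_space set"
  assumes "convex_cone C" "pointed_cone C" "F \<in> extreme_rays C"
  obtains v where "v \<in> C" "v \<noteq> 0" "F = ray v"
proof -
  have F: "F face_of C" "aff_dim F = 1"
    using assms unfolding extreme_rays_def by auto
  have "\<not> F \<subseteq> {0}"
    using F(2) aff_dim_subset[of F "{0}"] by auto
  then obtain v where "v \<in> F" "v \<noteq> 0"
    by blast
  with that show ?thesis
    using aff_dim_1_conic_face_eq_ray[OF assms] F face_of_imp_subset by blast
qed

text \<open>Minkowski's theorem for cones: apply Krein--Milman to the compact slice of the cone by
  the hyperplane on which the sum of the defining functionals equals one.\<close>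

theorem pointed_polyhedral_cone_eq_hull_extreme_rays:
  fixes C :: "'a::euclidean_space set"
  assumes "polyhedral_cone C" "pointed_cone C"
  shows "C = convex_cone hull (\<Union>(extreme_rays C))"
proof
  have C: "convex_cone C"
    by (rule convex_cone_polyhedral_cone[OF assms(1)])
  show "convex_cone hull (\<Union>(extreme_rays C)) \<subseteq> C"
    by (rule hull_minimal) (use C in \<open>auto simp: extreme_rays_def dest: face_of_imp_subset\<close>)
  obtain H where H: "finite H" "C = {x. \<forall>a\<in>H. a \<bullet> x \<ge> 0}"
    using assms(1) unfolding polyhedral_cone_def by blast
  define w where "w = \<Sum>H"
  have wsum: "w \<bullet> x = (\<Sum>a\<in>H. a \<bullet> x)" for x
    unfolding w_def by (rule inner_sum_left)
  have w0: "0 \<le> w \<bullet> x" if "x \<in> C" for x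
    unfolding wsum using that H by (auto intro: sum_nonneg)
  \<comment> \<open>A vanishing sum of nonnegative terms makes every functional vanish at
    \<open>x\<close>, so \<open>- x\<close> lies in the cone as well.\<close>
  have w1: "x = 0" if "x \<in> C" "w \<bullet> x = 0" for x
  proof -
    have "\<forall>a\<in>H. a \<bullet> x = 0"
      using that H unfolding wsum by (subst (asm) sum_nonneg_eq_0_iff) auto
    then have "- x \<in> C"
      using H by auto
    with that(1) show ?thesis
      using assms(2) C pointed_cone_iff by blast
  qed
  define K where "K = C \<inter> {x. w \<bullet> x = 1}"
  have clC: "closed C"
  proof -
    have "C = (\<Inter>a\<in>H. {x. a \<bullet> x \<ge> 0})"
      using H by auto
    then show ?thesis
      by (simp add: closed_INT closed_halfspace_ge)
  qed
  have cvC: "convex C"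
    using C unfolding convex_cone_def by blast
  have "convex K"
    unfolding K_def by (intro convex_Int cvC convex_hyperplane)
  have "bounded K"
  \<comment> \<open>Otherwise \<open>w\<close> attains a positive minimum on this compact set, and
    its reciprocal bounds the norm on the slice. Nonemptiness is required for the minimum to
    exist.\<close>
  proof (cases "C \<inter> sphere 0 1 = {}")
    case True
    have "x = 0" if "x \<in> C" for x
    proof (rule ccontr)
      assume "x \<noteq> 0"
      then have "(1 / norm x) *\<^sub>R x \<in> C \<inter> sphere 0 1"
        using convex_cone_scaleR[OF C _ that, of "1 / norm x"] by simp
      with True show False
        by blast
    qed
    then have "K \<subseteq> {0}"
      unfolding K_def by blast
    then show ?thesis
      by (rule bounded_subset[rotated]) simp
  next
    case False
    have "compact (C \<inter> sphere 0 1)"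
      using clC by (simp add: closed_Int_compact)
    then obtain z where z: "z \<in> C \<inter> sphere 0 1" "\<And>y. y \<in> C \<inter> sphere 0 1 \<Longrightarrow> w \<bullet> z \<le> w \<bullet> y"
      using continuous_attains_inf[OF _ False, of "\<lambda>x. w \<bullet> x"]
        continuous_on_inner[OF continuous_on_const continuous_on_id, of _ w] by blast
    have pos: "0 < w \<bullet> z"
      using w0[of z] w1[of z] z(1) by fastforce
    have "norm x \<le> 1 / (w \<bullet> z)" if "x \<in> K" for x
    proof -
      have x: "x \<in> C" "w \<bullet> x = 1"
        using that unfolding K_def by auto
      then have "x \<noteq> 0"
        by auto
      then have "(1 / norm x) *\<^sub>R x \<in> C \<inter> sphere 0 1"
        using convex_cone_scaleR[OF C _ x(1), of "1 / norm x"] by simp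
      then have "w \<bullet> z \<le> w \<bullet> ((1 / norm x) *\<^sub>R x)"
        by (rule z(2))
      then have "w \<bullet> z \<le> 1 / norm x"
        using x by simp
      then show ?thesis
        using pos \<open>x \<noteq> 0\<close> by (simp add: field_simps)
    qed
    then show ?thesis
      unfolding bounded_iff by blast
  qed
  then have "compact K"
    unfolding K_def using clC
    by (simp add: compact_eq_bounded_closed closed_Int closed_hyperplane)
  then have KM: "K = convex hull {x. x extreme_point_of K}"
    using \<open>convex K\<close> Krein_Milman_Minkowski by blast
  \<comment> \<open>If \<open>a + b\<close> lies on the ray, rescaling nonzero \<open>a\<close> and
    \<open>b\<close> into the slice exhibits \<open>x\<close> as a proper convex combination of the
    two, so extremality makes them equal.\<close>
  have ext: "ray x \<in> extreme_rays C" if "x extreme_point_of K" for x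
  proof -
    have x: "x \<in> C" "w \<bullet> x = 1"
      using that unfolding extreme_point_of_def K_def by auto
    then have "x \<noteq> 0"
      by auto
    have "ray x face_of C"
    proof (rule face_of_convex_coneI[OF C convex_cone_ray])
      show "ray x \<subseteq> C"
        unfolding ray_def using convex_cone_scaleR[OF C _ x(1)] by blast
      fix a b
      assume ab: "a \<in> C" "b \<in> C" "a + b \<in> ray x"
      then obtain s where s: "0 \<le> s" "a + b = s *\<^sub>R x"
        unfolding ray_def by blast
      define \<alpha> \<beta> where "\<alpha> = w \<bullet> a" and "\<beta> = w \<bullet> b"
      have nn: "0 \<le> \<alpha>" "0 \<le> \<beta>"
        using ab w0 unfolding \<alpha>_def \<beta>_def by auto
      have "\<alpha> + \<beta> = w \<bullet> (a + b)"
        unfolding \<alpha>_def \<beta>_def by (simp add: inner_right_distrib)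
      then have sum: "\<alpha> + \<beta> = s"
        using s x by simp
      show "a \<in> ray x \<and> b \<in> ray x"
      proof (cases "\<alpha> = 0 \<or> \<beta> = 0")
        case True
        then have "a = 0 \<or> b = 0"
          using w1 ab unfolding \<alpha>_def \<beta>_def by blast
        then show ?thesis
          using ab(3) zero_in_ray by auto
      next
        case False
        then have pos: "0 < \<alpha>" "0 < \<beta>" "0 < s"
          using nn sum by auto
        have "(1 / \<alpha>) *\<^sub>R a \<in> K" "(1 / \<beta>) *\<^sub>R b \<in> K"
          using pos convex_cone_scaleR[OF C _ ab(1), of "1/\<alpha>"]
            convex_cone_scaleR[OF C _ ab(2), of "1/\<beta>"]
          unfolding K_def by (auto simp: \<alpha>_def \<beta>_def)
        moreover have xeq: "x = (1 - \<beta> / s) *\<^sub>R (1 / \<alpha>) *\<^sub>R a + (\<beta> / s) *\<^sub>R (1 / \<beta>) *\<^sub>R b"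
        proof -
          have "1 - \<beta> / s = \<alpha> / s"
            using sum pos by (simp add: field_simps)
          then have "(1 - \<beta> / s) *\<^sub>R (1 / \<alpha>) *\<^sub>R a + (\<beta> / s) *\<^sub>R (1 / \<beta>) *\<^sub>R b
            = (1 / s) *\<^sub>R (a + b)"
            using pos by (simp add: scaleR_right_distrib)
          also have "\<dots> = x"
            using s pos by simp
          finally show ?thesis
            by simp
        qed
        moreover have "0 < \<beta> / s" "\<beta> / s < 1"
          using pos sum by auto
        ultimately have eq: "(1 / \<alpha>) *\<^sub>R a = (1 / \<beta>) *\<^sub>R b"
          using that unfolding extreme_point_of_def in_segment by blast
        have "x = (1 / \<beta>) *\<^sub>R b"
          using xeq unfolding eq by (metis scaleR_collapse)
        moreover from this have "x = (1 / \<alpha>) *\<^sub>R a"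
          using eq by simp
        ultimately have "a = \<alpha> *\<^sub>R x" "b = \<beta> *\<^sub>R x"
          using pos by (metis less_irrefl nonzero_divide_eq_eq scaleR_one scaleR_scaleR mult.commute)+
        then show ?thesis
          using nn unfolding ray_def by blast
      qed
    qed
    then show ?thesis
      unfolding extreme_rays_def using aff_dim_ray[OF \<open>x \<noteq> 0\<close>] by blast
  qed
  let ?D = "convex_cone hull (\<Union>(extreme_rays C))"
  have "{x. x extreme_point_of K} \<subseteq> ?D"
    using ext self_in_ray hull_subset[of "\<Union>(extreme_rays C)" convex_cone] by blast
  then have KD: "K \<subseteq> ?D"
    by (subst KM) (rule hull_minimal, simp_all add: convex_convex_cone_hull)
  show "C \<subseteq> ?D"
  proof
    fix x
    assume x: "x \<in> C"
    show "x \<in> ?D"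
    proof (cases "x = 0")
      case True
      then show ?thesis
        by (simp add: convex_cone_hull_contains_0)
    next
      case False
      then have pos: "0 < w \<bullet> x"
        using x w0[OF x] w1[OF x] by fastforce
      then have "(1 / (w \<bullet> x)) *\<^sub>R x \<in> K"
        unfolding K_def using convex_cone_scaleR[OF C _ x] by simp
      then have "(w \<bullet> x) *\<^sub>R (1 / (w \<bullet> x)) *\<^sub>R x \<in> ?D"
        by (rule convex_cone_hull_mul[OF subsetD[OF KD] less_imp_le[OF pos]])
      then show ?thesis
        using pos by simp
    qed
  qed
qed

subsection \<open>Frames with a normalised linear relation\<close>

text \<open>Sorted blocks fix a normal form. Index \<open>0\<close> is positive as soon as
  \<open>a > 0\<close>, and the last index lies in the zero block exactly when some coefficient
  vanishes.\<close>

definition sign_pattern :: "nat \<Rightarrow> nat \<Rightarrow> nat \<Rightarrow> real" where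
  "sign_pattern a b i = (if i < a then 1 else if i < a + b then - 1 else 0)"

text \<open>The index range has one element more than the dimension. Only linear data are assumed;
  pointedness and extremality are derived from the two lower bounds.\<close>

locale signed_frame =
  fixes f :: "nat \<Rightarrow> 'a::euclidean_space" and a b :: nat
  assumes a_ge: "2 \<le> a" and b_ge: "2 \<le> b" and ab_le: "a + b \<le> DIM('a) + 1"
    and spanning: "span (f ` {..DIM('a)}) = UNIV"
    and relation: "(\<Sum>i\<le>DIM('a). sign_pattern a b i *\<^sub>R f i) = 0"

abbreviation frame_cone :: "(nat \<Rightarrow> 'a::euclidean_space) \<Rightarrow> 'a set" where
  "frame_cone f \<equiv> cone_generated_by {..DIM('a)} f"

lemma independent_family_coeff_0:
  fixes f :: "'i \<Rightarrow> 'a::real_vector"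
  assumes "independent (f ` S)" "inj_on f S" "finite S" "(\<Sum>i\<in>S. u i *\<^sub>R f i) = 0" "i \<in> S"
  shows "u i = 0"
proof -
  have "(\<Sum>v\<in>f ` S. u (inv_into S f v) *\<^sub>R v) = (\<Sum>i\<in>S. u i *\<^sub>R f i)"
    using assms(2) by (subst sum.reindex) (auto intro!: sum.cong)
  then have "u (inv_into S f (f i)) = 0"
    using independentD[OF assms(1), of "f ` S" "\<lambda>v. u (inv_into S f v)" "f i"] assms by auto
  then show ?thesis
    using assms by simp
qed

lemma atMost_eq_insert_0: "{..n::nat} = insert 0 {1..n}"
  by auto

lemma sum_single_scaleR:
  fixes f :: "nat \<Rightarrow> 'a::real_vector"
  assumes "i \<le> n"
  shows "(\<Sum>j\<le>n. (if j = i then s else 0) *\<^sub>R f j) = s *\<^sub>R f i"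
  using assms by (simp add: if_distrib[of "\<lambda>c. c *\<^sub>R _"] cong: if_cong)

section \<open>Consequences of the unique linear relation\<close>

context signed_frame
begin

lemma f_0_eq: "f 0 = - (\<Sum>i\<in>{1..DIM('a)}. sign_pattern a b i *\<^sub>R f i)"
proof -
  have "sign_pattern a b 0 = 1"
    using a_ge by (simp add: sign_pattern_def)
  then show ?thesis
    using relation unfolding atMost_eq_insert_0 by (simp add: eq_neg_iff_add_eq_0)
qed

lemma span_tail: "span (f ` {1..DIM('a)}) = UNIV"
proof -
  have "f 0 \<in> span (f ` {1..DIM('a)})"
    unfolding f_0_eq by (intro span_neg span_sum span_mul span_base) auto
  then have "f ` {..DIM('a)} \<subseteq> span (f ` {1..DIM('a)})"
    unfolding atMost_eq_insert_0 by (auto intro: span_base)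
  then show ?thesis
    using spanning span_minimal[OF _ subspace_span] by blast
qed

text \<open>The tail spans and has at most as many members as the dimension; counting forces both
  independence and distinctness.\<close>

lemma independent_tail: "independent (f ` {1..DIM('a)})"
  and inj_on_tail: "inj_on f {1..DIM('a)}"
proof -
  have le: "card (f ` {1..DIM('a)}) \<le> DIM('a)"
    using card_image_le[of "{1..DIM('a)}" f] by simp
  show "independent (f ` {1..DIM('a)})"
    by (rule card_le_dim_spanning[of _ UNIV]) (use span_tail le in auto)
  have "DIM('a) \<le> card (f ` {1..DIM('a)})"
    using span_card_ge_dim[of "f ` {1..DIM('a)}" UNIV] span_tail by simp
  with le show "inj_on f {1..DIM('a)}"
    by (intro eq_card_imp_inj_on) auto
qed

lemma relation_unique:
  assumes "(\<Sum>i\<le>DIM('a). u i *\<^sub>R f i) = 0"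
  obtains k where "\<And>i. i \<le> DIM('a) \<Longrightarrow> u i = k * sign_pattern a b i"
proof -
  \<comment> \<open>Subtracting this multiple of the normalised relation kills the coefficient at
    \<open>0\<close> and leaves a relation on the independent tail.\<close>
  define d where "d i = u i - u 0 * sign_pattern a b i" for i
  have "(\<Sum>i\<le>DIM('a). d i *\<^sub>R f i)
      = (\<Sum>i\<le>DIM('a). u i *\<^sub>R f i) - u 0 *\<^sub>R (\<Sum>i\<le>DIM('a). sign_pattern a b i *\<^sub>R f i)"
    unfolding d_def by (simp add: scaleR_left_diff_distrib sum_subtractf scaleR_sum_right)
  then have sum0: "(\<Sum>i\<le>DIM('a). d i *\<^sub>R f i) = 0"
    using assms relation by simp
  have d0: "d 0 = 0"
    using a_ge unfolding d_def sign_pattern_def by simp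
  have "(\<Sum>i\<in>{1..DIM('a)}. d i *\<^sub>R f i) = 0"
    using sum0 d0 unfolding atMost_eq_insert_0 by simp
  then have "d i = 0" if "i \<in> {1..DIM('a)}" for i
    using independent_family_coeff_0[OF independent_tail inj_on_tail] that by blast
  with d0 have d: "d i = 0" if "i \<le> DIM('a)" for i
    using that by (cases "i = 0") auto
  have "u i = u 0 * sign_pattern a b i" if "i \<le> DIM('a)" for i
    using d[OF that] by (simp only: d_def right_minus_eq)
  with that show ?thesis
    by blast
qed

text \<open>The relation is \<open>k\<close> times the pattern. An index of each sign survives the
  removal of \<open>m\<close>, giving both \<open>0 \<le> k\<close> and \<open>0 \<le> - k\<close>.
  The free sign at \<open>m\<close> is what makes the extremality arguments possible.\<close>

lemma nonneg_relation_eq_0: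
  assumes "(\<Sum>j\<le>DIM('a). u j *\<^sub>R f j) = 0" "i \<le> DIM('a)"
    and nonneg: "\<And>j. j \<le> DIM('a) \<Longrightarrow> j \<noteq> m \<Longrightarrow> 0 \<le> u j"
  shows "u i = 0"
proof -
  obtain k where k: "\<And>i. i \<le> DIM('a) \<Longrightarrow> u i = k * sign_pattern a b i"
    using relation_unique[OF assms(1)] by blast
  \<comment> \<open>At least one of \<open>0\<close> and \<open>1\<close> differs from
    \<open>m\<close>; likewise one of \<open>a\<close> and \<open>a + 1\<close> below.\<close>
  obtain p where p: "p < a" "p \<noteq> m"
    using a_ge that[of 0] that[of 1] by linarith
  obtain q where q: "a \<le> q" "q < a + b" "q \<noteq> m"
    using b_ge that[of a] that[of "a + 1"] by linarith
  have "0 \<le> k"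
    using k[of p] nonneg[of p] p ab_le b_ge unfolding sign_pattern_def by auto
  moreover have "0 \<le> - k"
    using k[of q] nonneg[of q] q ab_le unfolding sign_pattern_def by auto
  ultimately show ?thesis
    using k assms(2) by simp
qed

lemma pointed_frame_cone: "pointed_cone (frame_cone f)"
  unfolding pointed_cone_iff[OF convex_cone_generated[OF finite_atMost]]
proof (intro allI impI)
  fix x
  assume "x \<in> frame_cone f \<and> - x \<in> frame_cone f"
  then obtain u v where u: "\<forall>i\<in>{..DIM('a)}. 0 \<le> u i" "x = (\<Sum>i\<le>DIM('a). u i *\<^sub>R f i)"
    and v: "\<forall>i\<in>{..DIM('a)}. 0 \<le> v i" "- x = (\<Sum>i\<le>DIM('a). v i *\<^sub>R f i)"
    unfolding cone_generated_by_def by blast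
  have "(\<Sum>i\<le>DIM('a). (u i + v i) *\<^sub>R f i) = x + - x"
    using u(2) v(2) by (simp add: scaleR_left_distrib sum.distrib)
  then have "u i + v i = 0" if "i \<le> DIM('a)" for i
    using nonneg_relation_eq_0[of "\<lambda>i. u i + v i" i] that u v by simp
  then have "u i = 0" if "i \<le> DIM('a)" for i
    using that u v by (metis add_nonneg_eq_0_iff atMost_iff)
  then show "x = 0"
    using u by simp
qed

lemma generator_nonzero:
  assumes "i \<le> DIM('a)"
  shows "f i \<noteq> 0"
proof
  assume "f i = 0"
  then have "(\<Sum>j\<le>DIM('a). (if j = i then 1 else 0) *\<^sub>R f j) = 0"
    using sum_single_scaleR[OF assms, of 1 f] by simp
  then have "(if i = i then 1 else 0 :: real) = 0"
    using nonneg_relation_eq_0[of "\<lambda>j. if j = i then 1 else 0" i i] assms by simp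
  then show False
    by simp
qed

lemma inj_on_ray: "inj_on (\<lambda>i. ray (f i)) {..DIM('a)}"
proof (rule inj_onI, rule ccontr)
  fix i j
  assume ij: "i \<in> {..DIM('a)}" "j \<in> {..DIM('a)}" "ray (f i) = ray (f j)" "i \<noteq> j"
  then obtain t where t: "0 < t" "f i = t *\<^sub>R f j"
    using ray_eqD generator_nonzero by (metis atMost_iff)
  \<comment> \<open>The relation \<open>f i - t *\<^sub>R f j = 0\<close>, whose only negative
    coefficient is at \<open>j\<close>.\<close>
  let ?u = "\<lambda>m. (if m = i then 1 else 0) + (if m = j then - t else 0)"
  have "(\<Sum>m\<le>DIM('a). ?u m *\<^sub>R f m) = 0"
    unfolding scaleR_left_distrib sum.distrib
    using ij t by (simp only: sum_single_scaleR atMost_iff) simp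
  then have "?u i = 0"
    by (rule nonneg_relation_eq_0[of ?u i j]) (use ij in auto)
  then show False
    using ij by simp
qed

lemma ray_face_of_frame_cone:
  assumes i: "i \<le> DIM('a)"
  shows "ray (f i) face_of frame_cone f"
proof (rule face_of_convex_coneI[OF convex_cone_generated[OF finite_atMost] convex_cone_ray])
  show "ray (f i) \<subseteq> frame_cone f"
    unfolding ray_def
    using convex_cone_scaleR[OF convex_cone_generated[OF finite_atMost] _ generator_in_cone[OF finite_atMost, of i _ f]] i
    by blast
  fix x y
  assume xy: "x \<in> frame_cone f" "y \<in> frame_cone f" "x + y \<in> ray (f i)"
  then obtain u v where u: "\<forall>i\<in>{..DIM('a)}. 0 \<le> u i" "x = (\<Sum>i\<le>DIM('a). u i *\<^sub>R f i)"
    and v: "\<forall>i\<in>{..DIM('a)}. 0 \<le> v i" "y = (\<Sum>i\<le>DIM('a). v i *\<^sub>R f i)"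
    unfolding cone_generated_by_def by blast
  obtain s where s: "0 \<le> s" "x + y = s *\<^sub>R f i"
    using xy unfolding ray_def by blast
  \<comment> \<open>Bringing \<open>s *\<^sub>R f i\<close> to the other side can create a negative
    coefficient only at \<open>i\<close>, so all others vanish.\<close>
  let ?w = "\<lambda>j. u j + v j + (if j = i then - s else 0)"
  have "(\<Sum>j\<le>DIM('a). ?w j *\<^sub>R f j) = x + y + (- s) *\<^sub>R f i"
    unfolding scaleR_left_distrib sum.distrib sum_single_scaleR[OF i] u(2) v(2) by simp
  then have "(\<Sum>j\<le>DIM('a). ?w j *\<^sub>R f j) = 0"
    using s by simp
  then have w: "?w j = 0" if "j \<le> DIM('a)" for j
    using nonneg_relation_eq_0[of ?w j i] that u v by auto
  have uv: "u j = 0 \<and> v j = 0" if "j \<le> DIM('a)" "j \<noteq> i" for j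
    using w[OF that(1)] that u v by (simp add: add_nonneg_eq_0_iff)
  have "x = (\<Sum>j\<le>DIM('a). (if j = i then u i else 0) *\<^sub>R f j)"
    unfolding u(2) by (rule sum.cong) (use uv in auto)
  moreover have "y = (\<Sum>j\<le>DIM('a). (if j = i then v i else 0) *\<^sub>R f j)"
    unfolding v(2) by (rule sum.cong) (use uv in auto)
  ultimately show "x \<in> ray (f i) \<and> y \<in> ray (f i)"
    unfolding sum_single_scaleR[OF i] ray_def using u(1) v(1) i by auto
qed

lemma extreme_rays_frame_cone: "extreme_rays (frame_cone f) = (\<lambda>i. ray (f i)) ` {..DIM('a)}"
proof
  show "(\<lambda>i. ray (f i)) ` {..DIM('a)} \<subseteq> extreme_rays (frame_cone f)"
    unfolding extreme_rays_def
    using ray_face_of_frame_cone aff_dim_ray generator_nonzero by auto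
  show "extreme_rays (frame_cone f) \<subseteq> (\<lambda>i. ray (f i)) ` {..DIM('a)}"
  proof
    fix F
    assume F: "F \<in> extreme_rays (frame_cone f)"
    have C: "convex_cone (frame_cone f)"
      by (simp add: convex_cone_generated)
    obtain v where v: "v \<in> frame_cone f" "v \<noteq> 0" "F = ray v"
      using extreme_ray_obtains_generator[OF C pointed_frame_cone F] by blast
    then obtain u where u: "\<forall>i\<in>{..DIM('a)}. 0 \<le> u i" "v = (\<Sum>i\<le>DIM('a). u i *\<^sub>R f i)"
      unfolding cone_generated_by_def by blast
    have "\<exists>i\<le>DIM('a). u i \<noteq> 0"
      using v(2) unfolding u(2) by (rule contrapos_np) simp
    then obtain i where i: "i \<le> DIM('a)" "u i \<noteq> 0"
      by blast
    have inC: "u j *\<^sub>R f j \<in> frame_cone f" if "j \<le> DIM('a)" for j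
      by (rule convex_cone_scaleR[OF C]) (use u that generator_in_cone[of _ j f] in auto)
    have "v = u i *\<^sub>R f i + (\<Sum>j\<in>{..DIM('a)} - {i}. u j *\<^sub>R f j)"
      unfolding u(2) using i by (intro sum.remove) auto
    moreover have "(\<Sum>j\<in>{..DIM('a)} - {i}. u j *\<^sub>R f j) \<in> frame_cone f"
      by (rule convex_cone_sum[OF C]) (use inC in auto)
    moreover have "F face_of frame_cone f"
      using F unfolding extreme_rays_def by blast
    \<comment> \<open>A face containing \<open>v\<close> contains every summand of \<open>v\<close>;
      a nonzero one determines the ray.\<close>
    ultimately have "u i *\<^sub>R f i \<in> F"
      using face_of_convex_cone_addD[OF C _ inC[OF i(1)]] v(3) self_in_ray by metis
    moreover have "u i *\<^sub>R f i \<noteq> 0"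
      using i generator_nonzero by simp
    ultimately have "F = ray (u i *\<^sub>R f i)"
      by (rule aff_dim_1_conic_face_eq_ray[OF C pointed_frame_cone F])
    then have "F = ray (f i)"
      using ray_scaleR[of "u i" "f i"] i u(1) by (simp add: less_le)
    then show "F \<in> (\<lambda>i. ray (f i)) ` {..DIM('a)}"
      using i by blast
  qed
qed

lemma full_dimensional_frame_cone: "full_dimensional (frame_cone f)"
proof -
  have "f ` {..DIM('a)} \<subseteq> frame_cone f"
    by (rule generators_subset_cone[OF finite_atMost])
  then have "span (frame_cone f) = UNIV"
    using spanning by (metis span_mono top.extremum_uniqueI)
  then have "dim (frame_cone f) = DIM('a)"
    using dim_span[of "frame_cone f"] by simp
  moreover have "0 \<in> affine hull (frame_cone f)"
    by (intro hull_inc convex_cone_contains_0 convex_cone_generated finite_atMost)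
  ultimately show ?thesis
    unfolding full_dimensional_def by (simp add: aff_dim_zero)
qed

lemma frame_cone_in_cones_with_rays: "frame_cone f \<in> cones_with_rays (DIM('a) + 1)"
proof -
  have "card (extreme_rays (frame_cone f)) = DIM('a) + 1"
    unfolding extreme_rays_frame_cone by (simp add: card_image[OF inj_on_ray])
  then show ?thesis
    unfolding cones_with_rays_def
    using pointed_frame_cone full_dimensional_frame_cone
      polyhedral_cone_generated[OF finite_atMost, where f = f] by simp
qed

text \<open>If the last generator is absent from the relation, its line is complementary to the span
  of the others. Conversely, a splitting cuts the relation into two parts; their sum is zero, so
  each part is itself a relation, and uniqueness puts all generators on one side.\<close>

lemma decomposable_frame_cone_iff: "decomposable (frame_cone f) \<longleftrightarrow> a + b < DIM('a) + 1"
proof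
  assume less: "a + b < DIM('a) + 1"
  let ?N = "DIM('a)"
  have N: "{..?N} = insert ?N {..<?N}" "finite (f ` {..<?N})"
    by auto
  show "decomposable (frame_cone f)"
    unfolding decomposable_def
  proof (intro exI conjI ballI)
    show "subspace (span {f ?N})" "subspace (span (f ` {..<?N}))"
      by simp_all
    show "span {f ?N} \<noteq> {0}"
      using generator_nonzero[of ?N] span_base[of "f ?N" "{f ?N}"] by auto
    have "f 0 \<in> span (f ` {..<?N})"
      by (intro span_base) auto
    then show "span (f ` {..<?N}) \<noteq> {0}"
      using generator_nonzero[of 0] by auto
    show "span {f ?N} \<inter> span (f ` {..<?N}) = {0}"
    proof
      show "span {f ?N} \<inter> span (f ` {..<?N}) \<subseteq> {0}"
      proof
        fix x
        assume x: "x \<in> span {f ?N} \<inter> span (f ` {..<?N})"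
        then obtain k where k: "x = k *\<^sub>R f ?N"
          by (auto simp: span_singleton)
        have "\<exists>u. x = (\<Sum>i<?N. u i *\<^sub>R f i)"
        proof -
          have "x \<in> span (f ` {..<?N})"
            using x by blast
          then show ?thesis
          proof (induction rule: span_induct_alt)
            case base
            then show ?case
              by (intro exI[of _ "\<lambda>_. 0"]) simp
          next
            case (step c y z)
            then obtain u i where "z = (\<Sum>i<?N. u i *\<^sub>R f i)" "y = f i" "i < ?N"
              by auto
            then show ?case
              by (intro exI[of _ "\<lambda>j. (if j = i then c else 0) + u j"])
                 (simp add: scaleR_left_distrib sum.distrib if_distrib[of "\<lambda>c. c *\<^sub>R _"] cong: if_cong)
          qed
        qed
        then obtain u where u: "x = (\<Sum>i<?N. u i *\<^sub>R f i)"
          by blast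
        \<comment> \<open>Two expressions for \<open>x\<close> give a relation with coefficient
          \<open>- k\<close> at the last index, where the pattern is zero.\<close>
        have "(\<Sum>i\<le>?N. (u(?N := - k)) i *\<^sub>R f i) = - k *\<^sub>R f ?N + (\<Sum>i<?N. u i *\<^sub>R f i)"
          unfolding N(1) by simp
        also have "\<dots> = 0"
          using k u by simp
        finally obtain l where "\<And>i. i \<le> ?N \<Longrightarrow> (u(?N := - k)) i = l * sign_pattern a b i"
          using relation_unique by blast
        from this[of ?N] have "k = 0"
          using less by (simp add: sign_pattern_def)
        then show "x \<in> {0}"
          using k by simp
      qed
    qed (simp add: span_zero)
    have "{x + y |x y. x \<in> span {f ?N} \<and> y \<in> span (f ` {..<?N})} = span ({f ?N} \<union> f ` {..<?N})"
      by (simp only: span_Un)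
    also have "{f ?N} \<union> f ` {..<?N} = f ` {..?N}"
      unfolding N(1) by simp
    finally show "{x + y |x y. x \<in> span {f ?N} \<and> y \<in> span (f ` {..<?N})} = UNIV"
      using spanning by simp
    fix R
    assume "R \<in> extreme_rays (frame_cone f)"
    then obtain i where i: "i \<le> ?N" "R = ray (f i)"
      unfolding extreme_rays_frame_cone by blast
    then show "R \<subseteq> span {f ?N} \<or> R \<subseteq> span (f ` {..<?N})"
      using ray_subset_span[of "f i" "{f ?N}"] ray_subset_span[of "f i" "f ` {..<?N}"]
      by (cases "i = ?N") auto
  qed
next
  assume "decomposable (frame_cone f)"
  then obtain V W where V: "subspace V" "V \<noteq> {0}" and W: "subspace W" "W \<noteq> {0}"
    and VW: "V \<inter> W = {0}" and rays: "\<forall>R\<in>extreme_rays (frame_cone f). R \<subseteq> V \<or> R \<subseteq> W"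
    unfolding decomposable_def by blast
  show "a + b < DIM('a) + 1"
  proof (rule ccontr)
    assume "\<not> ?thesis"
    then have ab: "a + b = DIM('a) + 1"
      using ab_le by simp
    then have nz: "sign_pattern a b i \<noteq> 0" if "i \<le> DIM('a)" for i
      using that unfolding sign_pattern_def by auto
    have VorW: "f i \<in> V \<or> f i \<in> W" if "i \<le> DIM('a)" for i
      using rays that self_in_ray unfolding extreme_rays_frame_cone by blast
    let ?c = "sign_pattern a b"
    let ?u = "\<lambda>i. if f i \<in> V then ?c i else 0"
    let ?v = "\<lambda>i. if f i \<in> V then 0 else ?c i"
    have inV: "(\<Sum>i\<le>DIM('a). ?u i *\<^sub>R f i) \<in> V"
      by (intro subspace_sum V) (auto intro: subspace_scale V simp: subspace_0[OF V(1)])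
    have inW: "(\<Sum>i\<le>DIM('a). ?v i *\<^sub>R f i) \<in> W"
      using VorW by (intro subspace_sum W) (auto intro: subspace_scale W simp: subspace_0[OF W(1)])
    have "(\<Sum>i\<le>DIM('a). ?u i *\<^sub>R f i) + (\<Sum>i\<le>DIM('a). ?v i *\<^sub>R f i)
        = (\<Sum>i\<le>DIM('a). ?c i *\<^sub>R f i)"
      by (subst sum.distrib[symmetric]) (rule sum.cong, auto)
    then have "(\<Sum>i\<le>DIM('a). ?u i *\<^sub>R f i) = - (\<Sum>i\<le>DIM('a). ?v i *\<^sub>R f i)"
      using relation by (simp add: eq_neg_iff_add_eq_0)
    then have "(\<Sum>i\<le>DIM('a). ?u i *\<^sub>R f i) \<in> V \<inter> W"
      using inV subspace_neg[OF W(1) inW] by simp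
    then have "(\<Sum>i\<le>DIM('a). ?u i *\<^sub>R f i) = 0"
      using VW by blast
    then obtain k where k: "\<And>i. i \<le> DIM('a) \<Longrightarrow> ?u i = k * ?c i"
      using relation_unique[of ?u] by blast
    \<comment> \<open>No pattern entry vanishes here, so \<open>k = 0\<close> means that no
      generator lies in \<open>V\<close>, and \<open>k \<noteq> 0\<close> that all do.\<close>
    have "V = UNIV \<or> W = UNIV"
    proof (cases "k = 0")
      case True
      then have "f ` {..DIM('a)} \<subseteq> W"
        using k nz VorW by (force split: if_splits)
      then show ?thesis
        using spanning span_minimal[OF _ W(1)] by blast
    next
      case False
      then have "f ` {..DIM('a)} \<subseteq> V"
        using k nz by (force split: if_splits)
      then show ?thesis
        using spanning span_minimal[OF _ V(1)] by blast
    qed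
    then show False
      using V W VW by auto
  qed
qed

lemma signed_frame_image:
  fixes A :: "'a \<Rightarrow> 'a"
  assumes "linear A" "surj A"
  shows "signed_frame (A \<circ> f) a b"
proof
  show "span ((A \<circ> f) ` {..DIM('a)}) = UNIV"
    using linear_span_image[OF assms(1), of "f ` {..DIM('a)}"] spanning assms(2)
    by (simp add: image_comp)
  have "(\<Sum>i\<le>DIM('a). sign_pattern a b i *\<^sub>R (A \<circ> f) i) = A (\<Sum>i\<le>DIM('a). sign_pattern a b i *\<^sub>R f i)"
    by (simp add: linear_sum[OF assms(1)] linear_scale[OF assms(1)])
  then show "(\<Sum>i\<le>DIM('a). sign_pattern a b i *\<^sub>R (A \<circ> f) i) = 0"
    using relation linear_0[OF assms(1)] by simp
qed (use a_ge b_ge ab_le in auto)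

end

section \<open>Frames up to linear isomorphism\<close>

lemma cone_generated_linear_image:
  assumes "linear A"
  shows "A ` cone_generated_by I f = cone_generated_by I (A \<circ> f)"
proof -
  have "A (\<Sum>i\<in>I. u i *\<^sub>R f i) = (\<Sum>i\<in>I. u i *\<^sub>R (A \<circ> f) i)" for u
    by (simp add: linear_sum[OF assms] linear_scale[OF assms])
  then show ?thesis
    unfolding cone_generated_by_def setcompr_eq_image by (simp only: image_image)
qed

lemma cone_generated_cong:
  assumes "\<And>i. i \<in> I \<Longrightarrow> f i = g i"
  shows "cone_generated_by I f = cone_generated_by I g"
proof -
  have "(\<Sum>i\<in>I. u i *\<^sub>R f i) = (\<Sum>i\<in>I. u i *\<^sub>R g i)" for u
    using assms by (intro sum.cong) auto
  then show ?thesis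
    unfolding cone_generated_by_def by (simp only:)
qed

text \<open>The map is prescribed on the basis formed by the tail. It respects index
  \<open>0\<close> automatically, because both frames express that vector by the same
  coefficients.\<close>

lemma signed_frames_same_type_linear_iso:
  fixes f g :: "nat \<Rightarrow> 'a::euclidean_space"
  assumes "signed_frame f a b" "signed_frame g a b"
  obtains A where "linear A" "bij A" "A ` frame_cone f = frame_cone g"
proof -
  interpret f: signed_frame f a b by fact
  interpret g: signed_frame g a b by fact
  let ?S = "{1..DIM('a)}"
  obtain A where A: "linear A" "\<forall>x\<in>f ` ?S. A x = g (inv_into ?S f x)"
    using linear_independent_extend[OF f.independent_tail, of "\<lambda>x. g (inv_into ?S f x)"] by blast
  have Ai: "A (f i) = g i" if "i \<in> ?S" for i
    using A(2) that f.inj_on_tail by simp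
  have "A (f 0) = g 0"
    unfolding f.f_0_eq g.f_0_eq linear_neg[OF A(1)] linear_sum[OF A(1)] linear_scale[OF A(1)]
    using Ai by simp
  with Ai have Ai: "A (f i) = g i" if "i \<in> {..DIM('a)}" for i
    using that unfolding atMost_eq_insert_0 by blast
  have "range A = span (A ` f ` {..DIM('a)})"
    using linear_span_image[OF A(1), of "f ` {..DIM('a)}"] f.spanning by simp
  also have "A ` f ` {..DIM('a)} = g ` {..DIM('a)}"
    unfolding image_image using Ai by (rule image_cong[OF refl])
  finally have "surj A"
    using g.spanning by simp
  moreover have "inj A"
    using linear_surjective_imp_injective[OF A(1)] \<open>surj A\<close> by simp
  moreover have "A ` frame_cone f = frame_cone g"
    unfolding cone_generated_linear_image[OF A(1)] using Ai by (intro cone_generated_cong) simp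
  ultimately show ?thesis
    using that A(1) by (simp add: bij_def)
qed

text \<open>The extreme rays recover the frame up to positive scaling and reordering, and the linear
  relation is unique up to a scalar, whose sign decides whether the two classes are swapped.\<close>

lemma signed_frames_same_cone:
  fixes f g :: "nat \<Rightarrow> 'a::euclidean_space"
  assumes "signed_frame f a b" "signed_frame g c d" "frame_cone f = frame_cone g"
  shows "a = c \<and> b = d \<or> a = d \<and> b = c"
proof -
  interpret f: signed_frame f a b by fact
  interpret g: signed_frame g c d by fact
  let ?I = "{..DIM('a)}"
  have rays: "(\<lambda>i. ray (f i)) ` ?I = (\<lambda>i. ray (g i)) ` ?I"
    using f.extreme_rays_frame_cone g.extreme_rays_frame_cone assms(3) by simp
  have "\<exists>\<sigma>. bij_betw \<sigma> ?I ?I \<and> (\<forall>i\<in>?I. ray (f (\<sigma> i)) = ray (g i))"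
  proof (intro exI conjI)
    let ?\<sigma> = "inv_into ?I (\<lambda>i. ray (f i)) \<circ> (\<lambda>i. ray (g i))"
    have "bij_betw (\<lambda>i. ray (g i)) ?I ((\<lambda>i. ray (f i)) ` ?I)"
      using g.inj_on_ray rays by (simp add: bij_betw_def)
    then show "bij_betw ?\<sigma> ?I ?I"
      using bij_betw_trans bij_betw_inv_into[OF inj_on_imp_bij_betw[OF f.inj_on_ray]] by blast
    show "\<forall>i\<in>?I. ray (f (?\<sigma> i)) = ray (g i)"
      using rays by (metis (no_types, lifting) comp_apply f_inv_into_f image_eqI)
  qed
  then obtain \<sigma> where \<sigma>: "bij_betw \<sigma> ?I ?I" "\<And>i. i \<in> ?I \<Longrightarrow> ray (g i) = ray (f (\<sigma> i))"
    by metis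
  have "\<exists>t>0. g i = t *\<^sub>R f (\<sigma> i)" if "i \<in> ?I" for i
    using ray_eqD[OF \<sigma>(2)[OF that]] g.generator_nonzero that by (metis atMost_iff)
  then obtain t where t: "\<And>i. i \<in> ?I \<Longrightarrow> 0 < t i \<and> g i = t i *\<^sub>R f (\<sigma> i)"
    by metis
  define \<tau> where "\<tau> = inv_into ?I \<sigma>"
  have \<tau>: "\<tau> (\<sigma> i) = i" if "i \<in> ?I" for i
    using \<sigma>(1) that unfolding \<tau>_def bij_betw_def by simp
  have \<sigma>I: "\<sigma> i \<in> ?I" if "i \<in> ?I" for i
    using \<sigma>(1) that bij_betwE by blast
  \<comment> \<open>The relation of \<open>g\<close> rewritten in terms of \<open>f\<close>:
    reindexed by the inverse permutation, with the positive scalings absorbed.\<close>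
  define u where "u j = sign_pattern c d (\<tau> j) * t (\<tau> j)" for j
  have "(\<Sum>j\<in>?I. u j *\<^sub>R f j) = (\<Sum>i\<in>?I. u (\<sigma> i) *\<^sub>R f (\<sigma> i))"
    by (rule sum.reindex_bij_betw[OF \<sigma>(1), symmetric])
  also have "\<dots> = (\<Sum>i\<in>?I. sign_pattern c d i *\<^sub>R g i)"
    by (rule sum.cong) (use t \<tau> in \<open>auto simp: u_def\<close>)
  finally have "(\<Sum>j\<in>?I. u j *\<^sub>R f j) = 0"
    using g.relation by simp
  then obtain k where "\<And>i. i \<le> DIM('a) \<Longrightarrow> u i = k * sign_pattern a b i"
    using f.relation_unique by blast
  then have "u (\<sigma> i) = k * sign_pattern a b (\<sigma> i)" if "i \<in> ?I" for i
    using \<sigma>I[OF that] by simp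
  then have k: "sign_pattern c d i * t i = k * sign_pattern a b (\<sigma> i)" if "i \<in> ?I" for i
    using that \<tau> unfolding u_def by simp
  \<comment> \<open>The sizes of the sign classes recover both parameters, and they survive positive
    scaling and reindexing.\<close>
  have pos: "{i \<in> ?I. 0 < sign_pattern p q i} = {..<p}"
    and neg: "{i \<in> ?I. sign_pattern p q i < 0} = {p..<p + q}" if "p + q \<le> DIM('a) + 1" for p q
    using that unfolding sign_pattern_def by (auto split: if_splits)
  have tsgn: "0 < sign_pattern c d i * t i \<longleftrightarrow> 0 < sign_pattern c d i"
    "sign_pattern c d i * t i < 0 \<longleftrightarrow> sign_pattern c d i < 0" if "i \<in> ?I" for i
    using t[OF that] by (auto simp: zero_less_mult_iff mult_less_0_iff)
  have im: "card {i \<in> ?I. P (\<sigma> i)} = card {i \<in> ?I. P i}" for P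
  proof (rule bij_betw_same_card)
    show "bij_betw \<sigma> {i \<in> ?I. P (\<sigma> i)} {i \<in> ?I. P i}"
      using \<sigma>(1) unfolding bij_betw_def by (auto intro: inj_on_subset)
  qed
  have "k \<noteq> 0"
    using k[of 0] t[of 0] g.a_ge by (auto simp: sign_pattern_def)
  then consider "0 < k" | "k < 0"
    by linarith
  then show ?thesis
  proof cases
    case 1
    have "{i \<in> ?I. 0 < sign_pattern c d i} = {i \<in> ?I. 0 < sign_pattern a b (\<sigma> i)}"
      "{i \<in> ?I. sign_pattern c d i < 0} = {i \<in> ?I. sign_pattern a b (\<sigma> i) < 0}"
      using 1 k tsgn by (auto simp: zero_less_mult_iff mult_less_0_iff)
    then have "card {..<c} = card {..<a}" "card {c..<c + d} = card {a..<a + b}"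
      using im[of "\<lambda>i. 0 < sign_pattern a b i"] im[of "\<lambda>i. sign_pattern a b i < 0"]
      using pos neg f.ab_le g.ab_le by metis+
    then show ?thesis
      by simp
  next
    case 2
    have "{i \<in> ?I. 0 < sign_pattern c d i} = {i \<in> ?I. sign_pattern a b (\<sigma> i) < 0}"
      "{i \<in> ?I. sign_pattern c d i < 0} = {i \<in> ?I. 0 < sign_pattern a b (\<sigma> i)}"
      using 2 k tsgn by (auto simp: zero_less_mult_iff mult_less_0_iff)
    then have "card {..<c} = card {a..<a + b}" "card {c..<c + d} = card {..<a}"
      using im[of "\<lambda>i. 0 < sign_pattern a b i"] im[of "\<lambda>i. sign_pattern a b i < 0"]
      using pos neg f.ab_le g.ab_le by metis+
    then show ?thesis
      by simp
  qed
qed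

lemma signed_frame_exists:
  assumes "2 \<le> a" "2 \<le> b" "a + b \<le> DIM('a::euclidean_space) + 1"
  shows "\<exists>f :: nat \<Rightarrow> 'a. signed_frame f a b"
proof -
  obtain h where h: "bij_betw h {1..DIM('a)} (Basis :: 'a set)"
    using finite_same_card_bij[of "{1..DIM('a)}" "Basis :: 'a set"] by auto
  \<comment> \<open>A basis occupies the indices from \<open>1\<close> on; the vector at
    \<open>0\<close> is solved for from the required relation.\<close>
  define f where "f i = (if i = 0 then - (\<Sum>j\<in>{1..DIM('a)}. sign_pattern a b j *\<^sub>R h j) else h i)" for i
  have "f ` {1..DIM('a)} = Basis"
    using h unfolding bij_betw_def f_def by auto
  then have "span (f ` {..DIM('a)}) = UNIV"
    using span_mono[OF image_mono[of "{1..DIM('a)}" "{..DIM('a)}" f]] by auto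
  moreover have "(\<Sum>i\<le>DIM('a). sign_pattern a b i *\<^sub>R f i) = 0"
    unfolding atMost_eq_insert_0 f_def using assms(1) by (simp add: sign_pattern_def)
  ultimately have "signed_frame f a b"
    using assms by unfold_locales
  then show ?thesis
    by blast
qed

subsection \<open>Every cone with one extreme ray more than the dimension comes from a frame\<close>

text \<open>One generator is picked on each extreme ray: Minkowski's theorem shows that they
  generate the cone, and full dimension makes them span.\<close>

lemma cone_generators_obtain:
  fixes C :: "'a::euclidean_space set"
  assumes "C \<in> cones_with_rays (DIM('a) + 1)"
  obtains g where "C = frame_cone g" "span (g ` {..DIM('a)}) = UNIV"
    "\<And>i. i \<le> DIM('a) \<Longrightarrow> g i \<noteq> 0"
    "\<And>i. i \<le> DIM('a) \<Longrightarrow> ray (g i) face_of C"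
    "inj_on (\<lambda>i. ray (g i)) {..DIM('a)}"
proof -
  have C: "polyhedral_cone C" "full_dimensional C" "pointed_cone C"
    "card (extreme_rays C) = DIM('a) + 1"
    using assms unfolding cones_with_rays_def by auto
  have cc: "convex_cone C"
    by (rule convex_cone_polyhedral_cone[OF C(1)])
  have "finite (extreme_rays C)"
    using C(4) by (intro card_ge_0_finite) simp
  then obtain e where e: "bij_betw e {..DIM('a)} (extreme_rays C)"
    using finite_same_card_bij[of "{..DIM('a)}" "extreme_rays C"] C(4) by auto
  have eI: "e i \<in> extreme_rays C" if "i \<le> DIM('a)" for i
    using bij_betwE[OF e] that by simp
  have "\<forall>i. \<exists>v. i \<le> DIM('a) \<longrightarrow> v \<in> C \<and> v \<noteq> 0 \<and> e i = ray v"
    using extreme_ray_obtains_generator[OF cc C(3) eI] by metis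
  then obtain g where g: "\<And>i. i \<le> DIM('a) \<Longrightarrow> g i \<in> C \<and> g i \<noteq> 0 \<and> e i = ray (g i)"
    by metis
  have gC: "frame_cone g \<subseteq> C"
    by (rule cone_generated_subset[OF cc]) (use g in auto)
  have "\<Union>(extreme_rays C) \<subseteq> frame_cone g"
  proof
    fix x
    assume "x \<in> \<Union>(extreme_rays C)"
    then obtain i where i: "i \<le> DIM('a)" "x \<in> e i"
      using e unfolding bij_betw_def by auto
    then obtain t where "0 \<le> t" "x = t *\<^sub>R g i"
      using g[OF i(1)] unfolding ray_def by auto
    moreover have "g i \<in> frame_cone g"
      by (rule generator_in_cone) (use i in auto)
    ultimately show "x \<in> frame_cone g"
      using convex_cone_scaleR[OF convex_cone_generated[OF finite_atMost]] by blast
  qed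
  then have "convex_cone hull \<Union>(extreme_rays C) \<subseteq> frame_cone g"
    by (rule hull_minimal) (rule convex_cone_generated[OF finite_atMost])
  then have Cg: "C = frame_cone g"
    using gC pointed_polyhedral_cone_eq_hull_extreme_rays[OF C(1,3)] by simp
  have "0 \<in> affine hull C"
    by (intro hull_inc convex_cone_contains_0 cc)
  then have "dim C = DIM('a)"
    using C(2) unfolding full_dimensional_def by (simp add: aff_dim_zero)
  then have "span C = UNIV"
    by (simp add: dim_eq_full)
  moreover have "C \<subseteq> span (g ` {..DIM('a)})"
    unfolding Cg by (rule cone_generated_subset[OF convex_cone_span span_superset])
  ultimately have "span (g ` {..DIM('a)}) = UNIV"
    using span_minimal[OF _ subspace_span] by blast
  moreover have "ray (g i) face_of C" if "i \<le> DIM('a)" for i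
    using eI[OF that] g[OF that] unfolding extreme_rays_def by auto
  moreover have "inj_on (\<lambda>i. ray (g i)) {..DIM('a)}"
    using e g unfolding bij_betw_def by (metis (no_types, lifting) atMost_iff inj_on_cong)
  ultimately show ?thesis
    using that[of g] Cg g by blast
qed

text \<open>With at most one positive coefficient, the relation would put another generator on the
  extreme ray of the positive one, or exhibit a line in the cone.\<close>

lemma two_positive_coefficients:
  fixes g :: "'i \<Rightarrow> 'a::euclidean_space"
  assumes I: "finite I" and pointed: "pointed_cone (cone_generated_by I g)"
    and nz: "\<And>i. i \<in> I \<Longrightarrow> g i \<noteq> 0"
    and face: "\<And>i. i \<in> I \<Longrightarrow> ray (g i) face_of cone_generated_by I g"
    and inj: "inj_on (\<lambda>i. ray (g i)) I"
    and rel: "(\<Sum>i\<in>I. c i *\<^sub>R g i) = 0" and c: "m \<in> I" "c m \<noteq> 0"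
  shows "2 \<le> card {i \<in> I. 0 < c i}"
proof (rule ccontr)
  assume "\<not> ?thesis"
  then have le: "card {i \<in> I. 0 < c i} \<le> 1"
    by simp
  let ?C = "cone_generated_by I g"
  have cc: "convex_cone ?C"
    by (rule convex_cone_generated[OF I])
  \<comment> \<open>Without a positive coefficient any index of \<open>I\<close> serves, here
    \<open>m\<close>.\<close>
  have "\<exists>p\<in>I. \<forall>i\<in>I. 0 < c i \<longrightarrow> i = p"
  proof (cases "{i \<in> I. 0 < c i} = {}")
    case True
    then show ?thesis
      using c(1) by blast
  next
    case False
    then obtain p where "p \<in> {i \<in> I. 0 < c i}"
      by blast
    moreover from this have "{i \<in> I. 0 < c i} = {p}"
      using card_seteq[of "{i \<in> I. 0 < c i}" "{p}"] le I by simp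
    ultimately show ?thesis
      by blast
  qed
  then obtain p where p: "p \<in> I" "\<And>i. i \<in> I \<Longrightarrow> i \<noteq> p \<Longrightarrow> c i \<le> 0"
    by (meson linorder_not_less)
  have gin: "g i \<in> ?C" if "i \<in> I" for i
    by (rule generator_in_cone[OF I that])
  have summand: "(- c i) *\<^sub>R g i \<in> ?C" if "i \<in> I" "c i \<le> 0" for i
    by (rule convex_cone_scaleR[OF cc _ gin[OF that(1)]]) (use that in simp)
  have split: "(- c j) *\<^sub>R g j = (\<Sum>i\<in>I - {j}. c i *\<^sub>R g i)" if "j \<in> I" for j
    using rel sum.remove[OF I that, of "\<lambda>i. c i *\<^sub>R g i"] by (simp add: neg_eq_iff_add_eq_0)
  show False
  proof (cases "0 < c p")
    case False
    have nonpos: "c i \<le> 0" if "i \<in> I" for i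
      using p(2)[OF that] False by (cases "i = p") auto
    have "(- c m) *\<^sub>R g m \<in> ?C"
      by (intro summand nonpos c(1))
    moreover have "(\<Sum>i\<in>I - {m}. (- c i) *\<^sub>R g i) \<in> ?C"
      by (rule convex_cone_sum[OF cc]) (use summand nonpos in blast)
    then have "- ((- c m) *\<^sub>R g m) \<in> ?C"
      unfolding split[OF c(1)] by (simp add: sum_negf)
    ultimately have "(- c m) *\<^sub>R g m = 0"
      using pointed pointed_cone_iff[OF cc] by blast
    then show False
      using c nz by simp
  next
    case True
    \<comment> \<open>All summands on the left lie in the cone, so the face property pushes each of
      them onto the ray of \<open>g p\<close>.\<close>
    have "(\<Sum>i\<in>I - {p}. (- c i) *\<^sub>R g i) = c p *\<^sub>R g p"
      using split[OF p(1)] by (simp add: sum_negf) (metis minus_minus)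
    then have sp: "(\<Sum>i\<in>I - {p}. (- c i) *\<^sub>R g i) \<in> ray (g p)"
      using True unfolding ray_def by (auto intro: less_imp_le)
    have "\<exists>j\<in>I - {p}. c j \<noteq> 0"
    proof (rule ccontr)
      assume "\<not> ?thesis"
      then have "(\<Sum>i\<in>I - {p}. c i *\<^sub>R g i) = 0"
        by simp
      then show False
        using split[OF p(1)] True nz[OF p(1)] by simp
    qed
    then obtain j where j: "j \<in> I" "j \<noteq> p" "c j \<noteq> 0"
      by blast
    then have "c j < 0"
      using p(2)[of j] by simp
    have "(\<Sum>i\<in>I - {p}. (- c i) *\<^sub>R g i)
        = (- c j) *\<^sub>R g j + (\<Sum>i\<in>I - {p} - {j}. (- c i) *\<^sub>R g i)"
      using j I by (intro sum.remove) auto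
    moreover have "(\<Sum>i\<in>I - {p} - {j}. (- c i) *\<^sub>R g i) \<in> ?C"
      by (rule convex_cone_sum[OF cc]) (use summand p(2) in auto)
    moreover have "(- c j) *\<^sub>R g j \<in> ?C"
      by (rule summand) (use j p(2) in auto)
    ultimately have "(- c j) *\<^sub>R g j \<in> ray (g p)"
      using face_of_convex_cone_addD[OF cc face[OF p(1)]] sp by metis
    then obtain s where s: "0 \<le> s" "(- c j) *\<^sub>R g j = s *\<^sub>R g p"
      unfolding ray_def by blast
    have "0 < s"
      using s nz[OF j(1)] j(3) by (cases "s = 0") auto
    have "ray (g j) = ray ((- c j) *\<^sub>R g j)"
      by (rule ray_scaleR[symmetric]) (use \<open>c j < 0\<close> in simp)
    also have "\<dots> = ray (g p)"
      unfolding s(2) by (rule ray_scaleR[OF \<open>0 < s\<close>])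
    finally show False
      using inj_onD[OF inj] j p(1) by blast
  qed
qed

text \<open>Bijections from three consecutive index blocks onto the positive, negative and zero
  positions are glued together.\<close>

lemma sign_sorting_permutation:
  fixes c :: "nat \<Rightarrow> real" and n :: nat
  defines "P \<equiv> {i \<in> {..n}. 0 < c i}" and "Q \<equiv> {i \<in> {..n}. c i < 0}"
  obtains \<pi> where "bij_betw \<pi> {..n} {..n}"
    "\<And>i. i \<le> n \<Longrightarrow> sgn (c (\<pi> i)) = sign_pattern (card P) (card Q) i"
    "card P + card Q \<le> n + 1"
proof -
  define Z where "Z = {i \<in> {..n}. c i = 0}"
  let ?a = "card P" and ?b = "card Q"
  have fin: "finite P" "finite Q" "finite Z"
    unfolding P_def Q_def Z_def by auto
  have un: "P \<union> Q \<union> Z = {..n}"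
    unfolding P_def Q_def Z_def by auto
  have disj: "P \<inter> Q = {}" "(P \<union> Q) \<inter> Z = {}"
    unfolding P_def Q_def Z_def by auto
  have "card (P \<union> Q \<union> Z) = ?a + ?b + card Z"
    using fin disj by (simp add: card_Un_disjoint)
  then have cards: "?a + ?b + card Z = n + 1"
    unfolding un by simp
  obtain h1 where h1: "bij_betw h1 {..<?a} P"
    using finite_same_card_bij[of "{..<?a}" P] fin by auto
  obtain h2 where h2: "bij_betw h2 {?a..<?a + ?b} Q"
    using finite_same_card_bij[of "{?a..<?a + ?b}" Q] fin by auto
  obtain h3 where h3: "bij_betw h3 {?a + ?b..<n + 1} Z"
    using finite_same_card_bij[of "{?a + ?b..<n + 1}" Z] fin cards by fastforce
  define \<pi> where "\<pi> i = (if i < ?a then h1 i else if i < ?a + ?b then h2 i else h3 i)" for i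
  have b1: "bij_betw \<pi> {..<?a} P"
    using h1 by (rule bij_betw_cong[THEN iffD1, rotated]) (auto simp: \<pi>_def)
  have b2: "bij_betw \<pi> {?a..<?a + ?b} Q"
    using h2 by (rule bij_betw_cong[THEN iffD1, rotated]) (auto simp: \<pi>_def)
  have b3: "bij_betw \<pi> {?a + ?b..<n + 1} Z"
    using h3 by (rule bij_betw_cong[THEN iffD1, rotated]) (auto simp: \<pi>_def)
  have "bij_betw \<pi> ({..<?a} \<union> {?a..<?a + ?b} \<union> {?a + ?b..<n + 1}) (P \<union> Q \<union> Z)"
    by (intro bij_betw_combine b1 b2 b3 disj)
  moreover have "{..<?a} \<union> {?a..<?a + ?b} \<union> {?a + ?b..<n + 1} = {..n}"
    using cards by auto
  ultimately have "bij_betw \<pi> {..n} {..n}"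
    unfolding un by simp
  moreover have "sgn (c (\<pi> i)) = sign_pattern ?a ?b i" if "i \<le> n" for i
  proof -
    consider "i < ?a" | "?a \<le> i" "i < ?a + ?b" | "?a + ?b \<le> i"
      by linarith
    then show ?thesis
    proof cases
      case 1
      then have "\<pi> i \<in> P"
        using bij_betwE[OF b1] by simp
      with 1 show ?thesis
        unfolding P_def sign_pattern_def by simp
    next
      case 2
      then have "\<pi> i \<in> Q"
        using bij_betwE[OF b2] by simp
      with 2 show ?thesis
        unfolding Q_def sign_pattern_def by simp
    next
      case 3
      then have "\<pi> i \<in> Z"
        using bij_betwE[OF b3] that by simp
      with 3 show ?thesis
        unfolding Z_def sign_pattern_def by simp
    qed
  qed
  ultimately show ?thesis
    using that cards by simp
qed

theorem cone_with_rays_obtains_signed_frame: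
  fixes C :: "'a::euclidean_space set"
  assumes "C \<in> cones_with_rays (DIM('a) + 1)"
  obtains f a b where "signed_frame f a b" "a \<le> b" "C = frame_cone f"
proof -
  let ?I = "{..DIM('a)}"
  obtain g where g: "C = frame_cone g" "span (g ` ?I) = UNIV"
    "\<And>i. i \<le> DIM('a) \<Longrightarrow> g i \<noteq> 0"
    "\<And>i. i \<le> DIM('a) \<Longrightarrow> ray (g i) face_of C"
    "inj_on (\<lambda>i. ray (g i)) ?I"
    using cone_generators_obtain[OF assms] by blast
  have pointed: "pointed_cone C"
    using assms unfolding cones_with_rays_def by blast
  \<comment> \<open>Dependence is a property of sets, so the image must really have one element more
    than the dimension.\<close>
  have "inj_on g ?I"
    using g(5) by (auto simp: inj_on_def)
  then have "card (g ` ?I) = DIM('a) + 1"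
    by (simp add: card_image)
  then have "dependent (g ` ?I)"
    by (intro dependent_biggerset) simp
  then obtain u v where u: "v \<in> g ` ?I" "u v \<noteq> 0" "(\<Sum>v\<in>g ` ?I. u v *\<^sub>R v) = 0"
    unfolding dependent_finite[OF finite_imageI[OF finite_atMost]] by blast
  define c where "c i = u (g i)" for i
  have c: "(\<Sum>i\<in>?I. c i *\<^sub>R g i) = 0"
    using u(3) \<open>inj_on g ?I\<close> unfolding c_def by (simp add: sum.reindex)
  obtain m where m: "m \<in> ?I" "c m \<noteq> 0"
    using u unfolding c_def by blast
  have two: "2 \<le> card {i \<in> ?I. 0 < d i}" if "(\<Sum>i\<in>?I. d i *\<^sub>R g i) = 0" "d m \<noteq> 0" for d
    by (rule two_positive_coefficients[OF _ _ _ _ g(5) that(1) m(1) that(2)])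
       (use g pointed in auto)
  \<comment> \<open>Either \<open>c\<close> or its negative; the sign is chosen so that the positive
    class is not the larger one.\<close>
  obtain d where d: "(\<Sum>i\<in>?I. d i *\<^sub>R g i) = 0" "d m \<noteq> 0"
    and le: "card {i \<in> ?I. 0 < d i} \<le> card {i \<in> ?I. d i < 0}"
  proof (cases "card {i \<in> ?I. 0 < c i} \<le> card {i \<in> ?I. c i < 0}")
    case True
    with that c m show ?thesis
      by blast
  next
    case False
    have "(\<Sum>i\<in>?I. (- c i) *\<^sub>R g i) = 0"
      using c by (simp add: sum_negf)
    with that[of "\<lambda>i. - c i"] False m show ?thesis
      by simp
  qed
  let ?a = "card {i \<in> ?I. 0 < d i}" and ?b = "card {i \<in> ?I. d i < 0}"
  obtain \<pi> where \<pi>: "bij_betw \<pi> ?I ?I"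
    "\<And>i. i \<le> DIM('a) \<Longrightarrow> sgn (d (\<pi> i)) = sign_pattern ?a ?b i"
    "?a + ?b \<le> DIM('a) + 1"
    using sign_sorting_permutation[of "DIM('a)" d] by blast
  \<comment> \<open>The generator absorbs the absolute value of its coefficient; the default
    \<open>1\<close> keeps the scaling positive where the coefficient is zero.\<close>
  define s where "s i = (if d i = 0 then 1 else \<bar>d i\<bar>)" for i
  have s: "0 < s i" "sgn (d i) * s i = d i" for i
    unfolding s_def by (auto simp: sgn_mult_abs)
  define f where "f i = s (\<pi> i) *\<^sub>R g (\<pi> i)" for i
  have \<pi>I: "\<pi> i \<in> ?I" if "i \<in> ?I" for i
    using bij_betwE[OF \<pi>(1)] that by blast
  have "f ` ?I \<subseteq> frame_cone g"
  proof (rule image_subsetI)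
    fix i
    assume "i \<in> ?I"
    then show "f i \<in> frame_cone g"
      unfolding f_def using s(1)[of "\<pi> i"]
      by (intro convex_cone_scaleR[OF convex_cone_generated[OF finite_atMost]]
          generator_in_cone[OF finite_atMost \<pi>I]) auto
  qed
  then have sub1: "frame_cone f \<subseteq> frame_cone g"
    by (rule cone_generated_subset[OF convex_cone_generated[OF finite_atMost]])
  have "g ` ?I \<subseteq> frame_cone f"
  proof (rule image_subsetI)
    fix j
    assume "j \<in> ?I"
    then obtain i where i: "i \<in> ?I" "j = \<pi> i"
      using \<pi>(1) unfolding bij_betw_def by blast
    have "g j = (1 / s j) *\<^sub>R f i"
      unfolding f_def i(2) using s(1)[of "\<pi> i"] by simp
    moreover have "(1 / s j) *\<^sub>R f i \<in> frame_cone f"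
      by (rule convex_cone_scaleR[OF convex_cone_generated[OF finite_atMost] _
            generator_in_cone[OF finite_atMost i(1)]])
         (use s(1)[of j] in simp)
    ultimately show "g j \<in> frame_cone f"
      by simp
  qed
  then have "frame_cone g \<subseteq> frame_cone f"
    by (rule cone_generated_subset[OF convex_cone_generated[OF finite_atMost]])
  with sub1 have Cf: "C = frame_cone f"
    using g(1) by simp
  have "g ` ?I \<subseteq> span (f ` ?I)"
    using \<open>g ` ?I \<subseteq> frame_cone f\<close>
      cone_generated_subset[OF convex_cone_span span_superset] by (rule order_trans)
  then have "span (f ` ?I) = UNIV"
    using g(2) span_minimal[OF _ subspace_span] by blast
  moreover have "(\<Sum>i\<in>?I. sign_pattern ?a ?b i *\<^sub>R f i) = 0"
  proof -
    have "(\<Sum>i\<in>?I. sign_pattern ?a ?b i *\<^sub>R f i) = (\<Sum>i\<in>?I. d (\<pi> i) *\<^sub>R g (\<pi> i))"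
    proof (rule sum.cong)
      fix i
      assume "i \<in> ?I"
      then have "sign_pattern ?a ?b i = sgn (d (\<pi> i))"
        using \<pi>(2) by simp
      then show "sign_pattern ?a ?b i *\<^sub>R f i = d (\<pi> i) *\<^sub>R g (\<pi> i)"
        unfolding f_def using s(2)[of "\<pi> i"] by simp
    qed simp
    also have "\<dots> = (\<Sum>i\<in>?I. d i *\<^sub>R g i)"
      by (rule sum.reindex_bij_betw[OF \<pi>(1)])
    finally show ?thesis
      using d by simp
  qed
  moreover have "2 \<le> ?a"
    using two[OF d] .
  moreover have "2 \<le> ?b"
    using two[of "\<lambda>i. - d i"] d by (simp add: sum_negf)
  ultimately have "signed_frame f ?a ?b"
    using \<pi>(3) by unfold_locales
  then show ?thesis
    using that le Cf by blast
qed

subsection \<open>Counting the classes\<close>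

definition cones_of_type :: "nat \<times> nat \<Rightarrow> 'a::euclidean_space set set" where
  "cones_of_type t = {frame_cone f | f. signed_frame f (fst t) (snd t)}"

text \<open>The parameter \<open>m\<close> stands for the number of rays, one more than the
  dimension.\<close>

definition cone_types :: "nat \<Rightarrow> (nat \<times> nat) set" where
  "cone_types m = {(a, b). 2 \<le> a \<and> a \<le> b \<and> a + b \<le> m}"

lemma cones_with_rays_eq:
  "(cones_with_rays (DIM('a) + 1) :: 'a::euclidean_space set set)
    = (\<Union>t\<in>cone_types (DIM('a) + 1). cones_of_type t)"
proof
  show "(cones_with_rays (DIM('a) + 1) :: 'a set set)
    \<subseteq> (\<Union>t\<in>cone_types (DIM('a) + 1). cones_of_type t)"
  proof
    fix C :: "'a set"
    assume "C \<in> cones_with_rays (DIM('a) + 1)"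
    then obtain f a b where f: "signed_frame f a b" "a \<le> b" "C = frame_cone f"
      by (rule cone_with_rays_obtains_signed_frame)
    then interpret signed_frame f a b
      by simp
    have "(a, b) \<in> cone_types (DIM('a) + 1)"
      using f(2) a_ge ab_le by (simp add: cone_types_def)
    moreover have "C \<in> cones_of_type (a, b)"
      using f by (auto simp: cones_of_type_def)
    ultimately show "C \<in> (\<Union>t\<in>cone_types (DIM('a) + 1). cones_of_type t)"
      by blast
  qed
  show "(\<Union>t\<in>cone_types (DIM('a) + 1). cones_of_type t)
    \<subseteq> (cones_with_rays (DIM('a) + 1) :: 'a set set)"
    using signed_frame.frame_cone_in_cones_with_rays by (auto simp: cones_of_type_def)
qed

lemma nondecomposable_cones_eq:
  "{C \<in> cones_with_rays (DIM('a) + 1) :: 'a::euclidean_space set set. \<not> decomposable C}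
    = (\<Union>t\<in>{(a, b) \<in> cone_types (DIM('a) + 1). a + b = DIM('a) + 1}. cones_of_type t)"
proof -
  have "\<not> decomposable C \<longleftrightarrow> a + b = DIM('a) + 1"
    if "C \<in> cones_of_type (a, b)" for C :: "'a set" and a b
  proof -
    from that obtain f where f: "signed_frame f a b" "C = frame_cone f"
      by (auto simp: cones_of_type_def)
    then interpret signed_frame f a b
      by simp
    show ?thesis
      using decomposable_frame_cone_iff f(2) ab_le by auto
  qed
  then show ?thesis
    unfolding cones_with_rays_eq by fast
qed

lemma projectively_equivalent_if_same_type:
  fixes C D :: "(real ^ 'n) set"
  assumes "C \<in> cones_of_type t" "D \<in> cones_of_type t"
  shows "projectively_equivalent C D"
proof -
  obtain f g where f: "signed_frame f (fst t) (snd t)" "C = frame_cone f"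
    and g: "signed_frame g (fst t) (snd t)" "D = frame_cone g"
    using assms by (auto simp: cones_of_type_def)
  obtain A where A: "linear A" "bij A" "A ` C = D"
    using signed_frames_same_type_linear_iso[OF f(1) g(1)] f(2) g(2) by blast
  have "(\<lambda>x. matrix A *v x) = A"
    using A(1) by (auto simp: matrix_works)
  moreover from this have "invertible (matrix A)"
    using A(2) unfolding invertible_left_inverse matrix_left_invertible_injective
    by (simp add: bij_is_inj)
  ultimately show ?thesis
    unfolding projectively_equivalent_def using A(3) by metis
qed

text \<open>The matrix carries a frame of \<open>C\<close> to a frame of \<open>D\<close> of the
  same type; comparing two frames of one cone leaves only a swap, which the ordering
  removes.\<close>

lemma projectively_equivalent_imp_same_type:
  fixes C D :: "(real ^ 'n) set"
  assumes "C \<in> cones_of_type t" "D \<in> cones_of_type t'" "projectively_equivalent C D"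
    and "fst t \<le> snd t" "fst t' \<le> snd t'"
  shows "t = t'"
proof -
  obtain f g where f: "signed_frame f (fst t) (snd t)" "C = frame_cone f"
    and g: "signed_frame g (fst t') (snd t')" "D = frame_cone g"
    using assms by (auto simp: cones_of_type_def)
  obtain A :: "real ^ 'n ^ 'n" where A: "invertible A" "(\<lambda>x. A *v x) ` C = D"
    using assms(3) unfolding projectively_equivalent_def by blast
  have lin: "linear ((*v) A)"
    by simp
  have "surj ((*v) A)"
    using A(1) matrix_right_invertible_surjective unfolding invertible_def by blast
  then have "signed_frame ((*v) A \<circ> f) (fst t) (snd t)"
    using signed_frame.signed_frame_image[OF f(1) lin] by blast
  moreover have "frame_cone ((*v) A \<circ> f) = frame_cone g"
    using A(2) f(2) g(2) cone_generated_linear_image[OF lin] by metis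
  ultimately show ?thesis
    using signed_frames_same_cone[OF _ g(1)] assms(4,5) by (metis order_antisym prod_eqI)
qed

text \<open>Each \<open>cones_of_type t\<close> with \<open>t\<close> in \<open>S\<close> is
  nonempty and is exactly one class. An arbitrary \<open>S\<close> serves both the non-decomposable
  count and the full count.\<close>

lemma card_projective_classes_types:
  assumes S: "S \<subseteq> cone_types (CARD('n) + 1)"
  shows "card (projective_classes (\<Union>t\<in>S. cones_of_type t :: (real ^ 'n) set set)) = card S"
proof -
  let ?K = "cones_of_type :: nat \<times> nat \<Rightarrow> (real ^ 'n) set set"
  let ?X = "\<Union>t\<in>S. ?K t"
  have ord: "fst t \<le> snd t" if "t \<in> S" for t
    using S that by (auto simp: cone_types_def)
  have cls: "projective_equivalence_on ?X `` {C} = ?K t" if "t \<in> S" "C \<in> ?K t" for t C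
  proof
    show "?K t \<subseteq> projective_equivalence_on ?X `` {C}"
      using that projectively_equivalent_if_same_type[OF that(2)]
      by (auto simp: projective_equivalence_on_def)
    show "projective_equivalence_on ?X `` {C} \<subseteq> ?K t"
      using that projectively_equivalent_imp_same_type[OF that(2)] ord
      by (auto simp: projective_equivalence_on_def)
  qed
  have ne: "?K t \<noteq> {}" if "t \<in> S" for t
  proof -
    have "2 \<le> fst t" "2 \<le> snd t" "fst t + snd t \<le> DIM(real ^ 'n) + 1"
      using S that by (auto simp: cone_types_def)
    then show ?thesis
      using signed_frame_exists[where 'a = "real ^ 'n"] by (auto simp: cones_of_type_def)
  qed
  have "projective_classes ?X = ?K ` S"
  proof
    show "projective_classes ?X \<subseteq> ?K ` S"
      unfolding projective_classes_def quotient_def using cls by auto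
    show "?K ` S \<subseteq> projective_classes ?X"
    proof (rule image_subsetI)
      fix t
      assume t: "t \<in> S"
      then obtain C where "C \<in> ?K t"
        using ne by blast
      with t show "?K t \<in> projective_classes ?X"
        unfolding projective_classes_def quotient_def using cls[OF t] by blast
    qed
  qed
  moreover have "inj_on ?K S"
  proof (rule inj_onI)
    fix t t'
    assume t: "t \<in> S" "t' \<in> S" "?K t = ?K t'"
    then obtain C where "C \<in> ?K t" "C \<in> ?K t'"
      using ne by blast
    then show "t = t'"
      using projectively_equivalent_imp_same_type projectively_equivalent_if_same_type ord t
      by metis
  qed
  ultimately show ?thesis
    by (simp add: card_image)
qed

section \<open>Counting the pairs\<close>

lemma card_types_full: "card {(a, b) \<in> cone_types m. a + b = m} = m div 2 - 1"
proof -
  have "{(a, b) \<in> cone_types m. a + b = m} = (\<lambda>a. (a, m - a)) ` {2..m div 2}"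
    by (auto simp: cone_types_def image_iff)
  moreover have "inj_on (\<lambda>a. (a, m - a)) {2..m div 2}"
    by (auto simp: inj_on_def)
  ultimately show ?thesis
    by (simp add: card_image)
qed

lemma finite_cone_types: "finite (cone_types m)"
  by (rule finite_subset[of _ "{..m} \<times> {..m}"]) (auto simp: cone_types_def)

lemma card_cone_types_Suc: "card (cone_types (Suc m)) = card (cone_types m) + (Suc m div 2 - 1)"
proof -
  let ?T = "{(a, b) \<in> cone_types (Suc m). a + b = Suc m}"
  have "cone_types (Suc m) = cone_types m \<union> ?T"
    by (auto simp: cone_types_def)
  moreover have "card (cone_types m \<union> ?T) = card (cone_types m) + card ?T"
  proof (rule card_Un_disjoint[OF finite_cone_types])
    show "finite ?T"
      by (rule finite_subset[OF _ finite_cone_types[of "Suc m"]]) auto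
    show "cone_types m \<inter> ?T = {}"
      by (auto simp: cone_types_def)
  qed
  ultimately show ?thesis
    unfolding card_types_full by simp
qed

text \<open>Raising \<open>p\<close> by one adds two diagonals, of \<open>p\<close> and
  \<open>p + 1\<close> pairs; treating both parities together lets each value feed the next.\<close>

lemma card_cone_types:
  "card (cone_types (2 * p + 1)) = p * (p - 1) \<and> card (cone_types (2 * p + 2)) = p\<^sup>2"
proof (induction p)
  case 0
  have "cone_types 1 = {}" "cone_types 2 = {}"
    by (auto simp: cone_types_def)
  then show ?case
    by (simp add: numeral_2_eq_2)
next
  case (Suc p)
  have "card (cone_types (2 * Suc p + 1)) = p\<^sup>2 + p"
    using card_cone_types_Suc[of "2 * p + 2"] Suc by simp
  moreover have "card (cone_types (2 * Suc p + 2)) = card (cone_types (2 * Suc p + 1)) + Suc p"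
    using card_cone_types_Suc[of "2 * Suc p + 1"] by simp
  ultimately show ?case
    by (simp add: power2_eq_square algebra_simps)
qed

theorem theorem4:
  assumes "CARD('n::finite) \<ge> 3"
  shows
    "int (card (projective_classes
        {C \<in> cones_with_rays (CARD('n) + 1) :: (real ^ 'n) set set. \<not> decomposable C}))
      = \<lfloor>(real CARD('n) - 1) / 2\<rfloor>
    \<and> (\<forall>p. CARD('n) = 2 * p \<longrightarrow>
        card (projective_classes (cones_with_rays (CARD('n) + 1) :: (real ^ 'n) set set))
          = p * (p - 1))
    \<and> (\<forall>p. CARD('n) = 2 * p + 1 \<longrightarrow>
        card (projective_classes (cones_with_rays (CARD('n) + 1) :: (real ^ 'n) set set)) = p\<^sup>2)"
proof -
  let ?n = "CARD('n)"
  have dim: "DIM(real ^ 'n) = ?n"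
    by simp
  have all: "card (projective_classes (cones_with_rays (?n + 1) :: (real ^ 'n) set set))
      = card (cone_types (?n + 1))"
    using card_projective_classes_types[where 'n = 'n, OF order_refl]
      cones_with_rays_eq[where 'a = "real ^ 'n"] unfolding dim by simp
  have "card (projective_classes
      {C \<in> cones_with_rays (?n + 1) :: (real ^ 'n) set set. \<not> decomposable C})
      = card {(a, b) \<in> cone_types (?n + 1). a + b = ?n + 1}"
    using nondecomposable_cones_eq[where 'a = "real ^ 'n"]
      card_projective_classes_types[where 'n = 'n, of "{(a, b) \<in> cone_types (?n + 1). a + b = ?n + 1}"]
    unfolding dim by auto
  also have "\<dots> = (?n + 1) div 2 - 1"
    by (rule card_types_full)
  also have "\<dots> = (?n - 1) div 2"
    by simp
  finally have nondec: "card (projective_classes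
      {C \<in> cones_with_rays (?n + 1) :: (real ^ 'n) set set. \<not> decomposable C}) = (?n - 1) div 2" .
  \<comment> \<open>Since the dimension is positive, natural subtraction agrees with real
    subtraction, and the floor becomes a natural division.\<close>
  have "(real ?n - 1) / 2 = real (?n - 1) / real 2"
    using assms by (simp add: of_nat_diff)
  then have "\<lfloor>(real ?n - 1) / 2\<rfloor> = int ((?n - 1) div 2)"
    by (simp only: floor_divide_of_nat_eq)
  with nondec all show ?thesis
    using card_cone_types by auto
qed

end
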